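(* Let $\omega_1,\dots,\omega_k>0$ be the (distinct) targeted frequencies, let $$V(s)=\frac1s\prod_{i=1}^k\frac{1}{s^2+\omega_i^2}$$ be the signal model, set $z(s)=1/V(s)$ and $n=2k+1$, and let $\Sigma[A_R,B_R,C_R,D_R]$ be a minimal state-space realization of $V(s)$ with state, input and output denoted by $x_R$, $u_R$, $y_R$. Consider the filter $$F(s)=\frac{\eta(s)/z(s)}{1+\eta(s)/z(s)},\qquad \eta(s)=K_\eta\begin{bmatrix}1& s&\cdots& s^{n-2}& s^{n-1}\end{bmatrix}^\intercal ,$$ where $K_\eta$ is the row vector of the coefficients of $\eta(s)$, regarded as the closed loop of the plant $1/z(s)=V(s)$ with the feedback controller $\eta(s)$. The optimal coefficients of $\eta(s)$ that minimize the quadratic cost $$\int_0^\infty x_R^\intercal\mathcal{Q}x_R+u_R^\intercal\mathcal{R}u_R\,\mathrm{d}t$$ are given by $$K_\eta=K\,O_R^{-1},$$ where $$O_R=\begin{bmatrix}C_R\\ C_RA_R\\ \vdots\\ C_RA_R^{n-1}\end{bmatrix}$$ is the observability matrix of the signal model and $K$ is the optimal state-feedback gain minimizing this cost for the filter in the state-feedback configuration $$\dot x_R=A_Rx_R+B_Ru_R,\qquad u_R=u_f-Kx_R,\qquad y_f=Kx_R$$ (with filter input $u_f$ and filter output $y_f$). Additionally, the resulting optimal filter with the optimal $\eta(s)$ has relative degree $n_r=1$.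
   Context: All systems are single-input single-output with real matrices; $\Sigma[A_R,B_R,C_R,D_R]$ denotes $\dot x_R=A_Rx_R+B_Ru_R$, $y_R=C_Rx_R+D_Ru_R$ with transfer function $V(s)$. In the filter interconnection the signals satisfy, in the Laplace domain, $Y_R=V(s)U_R$, $U_R=U_f-\eta(s)Y_R$ and $Y_f=\eta(s)Y_R$, so $F(s)=Y_f/U_f=\frac{\eta(s)}{z(s)+\eta(s)}$; equivalently $F=\frac{p-z}{p}$ with filter denominator $p(s)=z(s)+\eta(s)$. The optimization is the standard infinite-horizon LQR problem with $u_f=0$: $\mathcal{Q}=\mathcal{Q}^\intercal\succeq0$ and $\mathcal{R}>0$ are weights for which the problem has a (unique) stabilizing optimal state feedback $u_R=-Kx_R$ (e.g. $\mathcal{Q}\succ0$, $\mathcal{R}>0$). The relative degree of a rational transfer function is the degree of its denominator minus the degree of its numerator. *)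

theory Defs
  imports
    "HOL-Analysis.Analysis"
    "HOL-Computational_Algebra.Computational_Algebra"
    "HOL-Computational_Algebra.Field_as_Ring"
    "Jordan_Normal_Form.Gauss_Jordan_Elimination"
    "Jordan_Normal_Form.Char_Poly"
begin

unbundle no vec_syntax and no inner_syntax

text \<open>
  Transfer functions are rational functions in \<open>s\<close>, i.e. elements of the fraction field
  of the real polynomials.
\<close>

type_synonym ratfun = "real poly fract"

definition ratfun_s :: ratfun where
  "ratfun_s = to_fract [:0, 1:]"

definition ratfun_const :: "real \<Rightarrow> ratfun" where
  "ratfun_const c = to_fract [:c:]"

text \<open>
  The pair \<open>quot_of_fract f\<close> is the reduced representation (numerator, denominator) of \<open>f\<close>.
\<close>

definition relative_degree :: "ratfun \<Rightarrow> int" where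
  "relative_degree f =
     int (degree (snd (quot_of_fract f))) - int (degree (fst (quot_of_fract f)))"

definition signal_model :: "nat \<Rightarrow> (nat \<Rightarrow> real) \<Rightarrow> ratfun" where
  "signal_model k \<omega> =
     1 / ratfun_s * (\<Prod>i=1..k. 1 / (ratfun_s ^ 2 + ratfun_const ((\<omega> i)\<^sup>2)))"

text \<open>
  Single-input single-output systems with \<open>m\<close> states have \<open>A\<close> of size \<open>m \<times> m\<close>, \<open>B\<close> of size
  \<open>m \<times> 1\<close>, \<open>C\<close> of size \<open>1 \<times> m\<close> and \<open>D\<close> of size \<open>1 \<times> 1\<close>; the signals \<open>u\<close> and \<open>y\<close> are
  real-valued.  The transfer function \<open>C (s I - A)\<^sup>-\<^sup>1 B + D\<close> is computed with matrices over
  the field of rational functions, where \<open>s I - A\<close> is always invertible.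
\<close>

definition transfer_function ::
    "real mat \<Rightarrow> real mat \<Rightarrow> real mat \<Rightarrow> real mat \<Rightarrow> ratfun" where
  "transfer_function A B C D =
     (let M = map_mat ratfun_const;
          Resolvent = the (mat_inverse (ratfun_s \<cdot>\<^sub>m 1\<^sub>m (dim_row A) - M A))
      in (M C * Resolvent * M B + M D) $$ (0, 0))"

definition realization ::
    "ratfun \<Rightarrow> nat \<Rightarrow> real mat \<Rightarrow> real mat \<Rightarrow> real mat \<Rightarrow> real mat \<Rightarrow> bool" where
  "realization V m A B C D \<longleftrightarrow>
     A \<in> carrier_mat m m \<and> B \<in> carrier_mat m 1 \<and> C \<in> carrier_mat 1 m \<and> D \<in> carrier_mat 1 1 \<and>
     transfer_function A B C D = V"

definition minimal_realization ::
    "ratfun \<Rightarrow> nat \<Rightarrow> real mat \<Rightarrow> real mat \<Rightarrow> real mat \<Rightarrow> real mat \<Rightarrow> bool" where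
  "minimal_realization V m A B C D \<longleftrightarrow>
     realization V m A B C D \<and>
     (\<forall>m' A' B' C' D'. realization V m' A' B' C' D' \<longrightarrow> m \<le> m')"

definition observability_matrix :: "nat \<Rightarrow> real mat \<Rightarrow> real mat \<Rightarrow> real mat" where
  "observability_matrix n A C = mat n (dim_col C) (\<lambda>(i, j). (C * A ^\<^sub>m i) $$ (0, j))"

definition hurwitz :: "real mat \<Rightarrow> bool" where
  "hurwitz A \<longleftrightarrow> (\<forall>e. eigenvalue (map_mat complex_of_real A) e \<longrightarrow> Re e < 0)"

definition pos_semidef :: "nat \<Rightarrow> real mat \<Rightarrow> bool" where
  "pos_semidef m Q \<longleftrightarrow>
     Q \<in> carrier_mat m m \<and> transpose_mat Q = Q \<and> (\<forall>v\<in>carrier_vec m. v \<bullet> (Q *\<^sub>v v) \<ge> 0)"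

text \<open>
  \<open>state_response A B x0 u x\<close>: on the time axis \<open>t \<ge> 0\<close>, \<open>x\<close> is the state trajectory
  generated by the continuous input \<open>u\<close> from the initial state \<open>x0\<close> (the derivative at
  \<open>t = 0\<close> is one-sided).
\<close>

definition state_response ::
    "real mat \<Rightarrow> real mat \<Rightarrow> real vec \<Rightarrow> (real \<Rightarrow> real) \<Rightarrow> (real \<Rightarrow> real vec) \<Rightarrow> bool" where
  "state_response A B x0 u x \<longleftrightarrow>
     continuous_on {0..} u \<and> x 0 = x0 \<and>
     (\<forall>t\<ge>0. x t \<in> carrier_vec (dim_row A) \<and>
       (\<forall>i<dim_row A. ((\<lambda>\<tau>. x \<tau> $ i) has_real_derivative
          (A *\<^sub>v x t + u t \<cdot>\<^sub>v col B 0) $ i) (at t within {0..})))"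

text \<open>The integrand is nonnegative for the weights in use; a divergent cost has value \<open>\<infinity>\<close>.\<close>

definition quadratic_cost ::
    "real mat \<Rightarrow> real \<Rightarrow> (real \<Rightarrow> real vec) \<Rightarrow> (real \<Rightarrow> real) \<Rightarrow> ennreal" where
  "quadratic_cost Q R x u =
     (\<integral>\<^sup>+ t\<in>{0..}. ennreal (x t \<bullet> (Q *\<^sub>v x t) + u t * R * u t) \<partial>lborel)"

definition state_feedback_filter ::
    "real mat \<Rightarrow> real mat \<Rightarrow> real mat \<Rightarrow> real vec \<Rightarrow> (real \<Rightarrow> real) \<Rightarrow>
     (real \<Rightarrow> real vec) \<Rightarrow> (real \<Rightarrow> real) \<Rightarrow> (real \<Rightarrow> real) \<Rightarrow> bool" where
  "state_feedback_filter A B K x0 uf x u yf \<longleftrightarrow>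
     state_response A B x0 u x \<and>
     (\<forall>t\<ge>0. yf t = row K 0 \<bullet> x t \<and> u t = uf t - yf t)"

text \<open>
  The infinite-horizon LQR problem: \<open>u = - K x\<close> is stabilizing and, from every initial state,
  attains the least cost among all inputs.
\<close>

definition lqr_optimal_gain ::
    "real mat \<Rightarrow> real mat \<Rightarrow> real mat \<Rightarrow> real \<Rightarrow> real mat \<Rightarrow> bool" where
  "lqr_optimal_gain A B Q R K \<longleftrightarrow>
     K \<in> carrier_mat 1 (dim_row A) \<and> hurwitz (A - B * K) \<and>
     (\<forall>x0\<in>carrier_vec (dim_row A).
        \<exists>x u yf. state_feedback_filter A B K x0 (\<lambda>_. 0) x u yf \<and>
          (\<forall>x' u'. state_response A B x0 u' x' \<longrightarrow>
             quadratic_cost Q R x u \<le> quadratic_cost Q R x' u'))"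

text \<open>
  A coefficient vector \<open>K\<^sub>\<eta>\<close> is a \<open>1 \<times> n\<close> matrix, \<open>n\<close> being its number of columns.
\<close>

definition eta :: "real mat \<Rightarrow> real poly" where
  "eta K\<eta> = (\<Sum>j<dim_col K\<eta>. monom (K\<eta> $$ (0, j)) j)"

definition filter_tf :: "ratfun \<Rightarrow> real mat \<Rightarrow> ratfun" where
  "filter_tf V K\<eta> =
     (let z = 1 / V; \<eta> = to_fract (eta K\<eta>) in (\<eta> / z) / (1 + \<eta> / z))"

text \<open>
  Time-domain closed loop of the plant with the controller \<open>\<eta>(s)\<close>, where \<open>s\<close> acts as
  differentiation: \<open>yd j\<close> is the \<open>j\<close>-th derivative of the plant output \<open>y = C x + D u\<close>,
  \<open>yf = \<eta>(d/dt) y\<close> and \<open>u = uf - yf\<close>.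
\<close>

definition eta_filter ::
    "real mat \<Rightarrow> real mat \<Rightarrow> real mat \<Rightarrow> real mat \<Rightarrow> real mat \<Rightarrow> real vec \<Rightarrow> (real \<Rightarrow> real) \<Rightarrow>
     (real \<Rightarrow> real vec) \<Rightarrow> (real \<Rightarrow> real) \<Rightarrow> (real \<Rightarrow> real) \<Rightarrow> bool" where
  "eta_filter A B C D K\<eta> x0 uf x u yf \<longleftrightarrow>
     state_response A B x0 u x \<and>
     (\<exists>yd :: nat \<Rightarrow> real \<Rightarrow> real.
        (\<forall>t\<ge>0. yd 0 t = row C 0 \<bullet> x t + D $$ (0, 0) * u t) \<and>
        (\<forall>j. Suc j < dim_col K\<eta> \<longrightarrow>
           (\<forall>t\<ge>0. (yd j has_real_derivative yd (Suc j) t) (at t within {0..}))) \<and>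
        (\<forall>t\<ge>0. yf t = (\<Sum>j<dim_col K\<eta>. K\<eta> $$ (0, j) * yd j t) \<and> u t = uf t - yf t))"

definition optimal_eta_coeffs ::
    "nat \<Rightarrow> real mat \<Rightarrow> real mat \<Rightarrow> real mat \<Rightarrow> real mat \<Rightarrow> real mat \<Rightarrow> real \<Rightarrow> real mat \<Rightarrow> bool"
    where
  "optimal_eta_coeffs n A B C D Q R K\<eta> \<longleftrightarrow>
     K\<eta> \<in> carrier_mat 1 n \<and>
     (\<forall>x0\<in>carrier_vec (dim_row A).
        \<exists>x u yf. eta_filter A B C D K\<eta> x0 (\<lambda>_. 0) x u yf \<and>
          (\<forall>K\<eta>'\<in>carrier_mat 1 n. \<forall>x' u' yf'.
             eta_filter A B C D K\<eta>' x0 (\<lambda>_. 0) x' u' yf' \<longrightarrow>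
             quadratic_cost Q R x u \<le> quadratic_cost Q R x' u'))"

end

theory Submission
  imports Defs "Jordan_Normal_Form.Schur_Decomposition"
begin

text \<open>
  Write \<open>p = 1 / V\<close>. Minimality forces the state dimension to be \<open>n\<close>, \<open>D = 0\<close>, \<open>det (s I - A) = p\<close>
  and \<open>C adj(s I - A) B = 1\<close>; comparing degrees in \<open>C A\<^sup>i adj(s I - A) B\<close> shows that the Markov
  parameters \<open>C A\<^sup>i B\<close> are \<open>0\<close> for \<open>i < n - 1\<close> and \<open>1\<close> for \<open>i = n - 1\<close>. Hence the observability
  matrix \<open>O\<close> is invertible and the output derivatives of order below \<open>n\<close> are the entries of
  \<open>O x\<close>, so feeding back \<open>\<eta>(d/dt) y\<close> is the same as the state feedback \<open>K\<^sub>\<eta> O\<close>.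

  A stabilizing gain has finite cost, and the parallelogram identity for the cost shows that
  two optimal inputs agree at time \<open>0\<close>; as the initial state is arbitrary, the optimal gain
  is unique. Finally, the leading coefficient of \<open>\<eta>\<close> is \<open>K B = tr A - tr (A - B K)\<close>, where \<open>tr A = 0\<close>
  because \<open>p\<close> is odd, and \<open>tr (A - B K) < 0\<close> because \<open>A - B K\<close> is Hurwitz.
\<close>

section \<open>Transfer functions and state-space realizations\<close>

lemma mat_inverse_det_nonzero:
  fixes M :: "'a :: field mat"
  assumes M: "M \<in> carrier_mat n n" and "det M \<noteq> 0"
  shows "the (mat_inverse M) \<in> carrier_mat n n" "M * the (mat_inverse M) = 1\<^sub>m n"
    "the (mat_inverse M) * M = 1\<^sub>m n"
proof -
  have "M \<in> Units (ring_mat TYPE('a) n n)" by (rule det_non_zero_imp_unit[OF assms])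
  with mat_inverse(1)[OF M] obtain N where N: "mat_inverse M = Some N" by fastforce
  from mat_inverse(2)[OF M N] show "the (mat_inverse M) \<in> carrier_mat n n"
    "M * the (mat_inverse M) = 1\<^sub>m n" "the (mat_inverse M) * M = 1\<^sub>m n" by (auto simp: N)
qed

abbreviation const_mat :: "real mat \<Rightarrow> real poly mat" where
  "const_mat \<equiv> map_mat (\<lambda>a. [:a:])"

text \<open>The numerator of \<open>C (s I - A)^-1 B\<close> over the denominator
  \<open>char_poly A\<close>. Using the adjugate keeps it a polynomial, so degrees and coefficients
  can be compared.\<close>

definition tf_numerator :: "real mat \<Rightarrow> real mat \<Rightarrow> real mat \<Rightarrow> real poly" where
  "tf_numerator A B C =
     (const_mat C * adj_mat (char_poly_matrix A) * const_mat B) $$ (0, 0)"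

interpretation to_fract: inj_comm_ring_hom "to_fract :: real poly \<Rightarrow> ratfun"
  by unfold_locales auto

lemma map_ratfun_const: "map_mat ratfun_const M = map_mat to_fract (const_mat M)"
  by (intro eq_matI) (auto simp: ratfun_const_def)

lemma resolvent_eq:
  assumes "A \<in> carrier_mat n n"
  shows "ratfun_s \<cdot>\<^sub>m 1\<^sub>m n - map_mat ratfun_const A = map_mat to_fract (char_poly_matrix A)"
  using assms
  by (intro eq_matI)
     (auto simp: ratfun_const_def ratfun_s_def char_poly_matrix_def one_pCons
       simp flip: to_fract_diff to_fract_uminus)

text \<open>The determinant of \<open>s I - A\<close> is the embedded characteristic polynomial,
  which is monic and hence nonzero; this justifies applying \<open>the\<close> to the result of
  \<open>mat_inverse\<close>.\<close>

lemma resolvent_inverse: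
  assumes A: "A \<in> carrier_mat n n"
  defines "S \<equiv> ratfun_s \<cdot>\<^sub>m 1\<^sub>m n - map_mat ratfun_const A"
  defines "T \<equiv> the (mat_inverse S)"
  shows "T \<in> carrier_mat n n" "S * T = 1\<^sub>m n" "T * S = 1\<^sub>m n"
proof -
  have S: "S \<in> carrier_mat n n" unfolding S_def using A by auto
  have "det S = to_fract (char_poly A)"
    unfolding S_def resolvent_eq[OF A] char_poly_def by (rule to_fract.hom_det)
  moreover have "char_poly A \<noteq> 0" using degree_monic_char_poly[OF A] by auto
  ultimately have "det S \<noteq> 0" by simp
  from mat_inverse_det_nonzero[OF S this]
  show "T \<in> carrier_mat n n" "S * T = 1\<^sub>m n" "T * S = 1\<^sub>m n" by (simp_all add: T_def)
qed

text \<open>Multiplying \<open>S * J = char_poly A * I\<close> from the left by the inverse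
  \<open>T\<close> of \<open>S\<close> trades the resolvent for a matrix with polynomial
  entries.\<close>

lemma resolvent_adj:
  assumes A: "A \<in> carrier_mat n n"
  shows "to_fract (char_poly A) \<cdot>\<^sub>m the (mat_inverse (ratfun_s \<cdot>\<^sub>m 1\<^sub>m n - map_mat ratfun_const A))
         = map_mat to_fract (adj_mat (char_poly_matrix A))"
proof -
  define S where "S = ratfun_s \<cdot>\<^sub>m 1\<^sub>m n - map_mat ratfun_const A"
  define T where "T = the (mat_inverse S)"
  define J where "J = map_mat to_fract (adj_mat (char_poly_matrix A))"
  note T = resolvent_inverse[OF A, folded S_def, folded T_def]
  have cm: "char_poly_matrix A \<in> carrier_mat n n" using A by simp
  have S: "S \<in> carrier_mat n n" unfolding S_def using A by auto
  have J: "J \<in> carrier_mat n n" unfolding J_def using adj_mat(1)[OF cm] by simp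
  have "S * J = map_mat to_fract (char_poly_matrix A * adj_mat (char_poly_matrix A))"
    unfolding S_def J_def resolvent_eq[OF A] using to_fract.mat_hom_mult[OF cm adj_mat(1)[OF cm]] by simp
  also have "\<dots> = to_fract (char_poly A) \<cdot>\<^sub>m 1\<^sub>m n"
    unfolding adj_mat(2)[OF cm] char_poly_def[symmetric] by (intro eq_matI) auto
  finally have SJ: "S * J = to_fract (char_poly A) \<cdot>\<^sub>m 1\<^sub>m n" .
  have "J = (T * S) * J" unfolding T(3) using J by simp
  also have "\<dots> = T * (S * J)" by (rule assoc_mult_mat[OF T(1) S J])
  also have "\<dots> = to_fract (char_poly A) \<cdot>\<^sub>m T" unfolding SJ using T(1)
    by (simp add: mult_smult_distrib[OF T(1) one_carrier_mat])
  finally show ?thesis unfolding T_def S_def J_def by simp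
qed

text \<open>Clears the denominator, so that a statement about a transfer function becomes an
  identity between polynomials.\<close>

lemma transfer_function_numerator:
  assumes A: "A \<in> carrier_mat n n" and B: "B \<in> carrier_mat n 1" and C: "C \<in> carrier_mat 1 n"
    and D: "D \<in> carrier_mat 1 1"
  shows "to_fract (char_poly A) * transfer_function A B C D
         = to_fract (tf_numerator A B C + [:D $$ (0, 0):] * char_poly A)"
proof -
  define T where "T = the (mat_inverse (ratfun_s \<cdot>\<^sub>m 1\<^sub>m n - map_mat ratfun_const A))"
  define J where "J = adj_mat (char_poly_matrix A)"
  have J: "J \<in> carrier_mat n n" unfolding J_def using adj_mat(1)[of "char_poly_matrix A" n] A by simp
  have T: "T \<in> carrier_mat n n" unfolding T_def using resolvent_inverse[OF A] by simp
  let ?B = "map_mat ratfun_const B" and ?C = "map_mat ratfun_const C" and ?c = "to_fract (char_poly A)"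
  have TJ: "?c \<cdot>\<^sub>m T = map_mat to_fract J" unfolding T_def J_def by (rule resolvent_adj[OF A])
  have B': "?B \<in> carrier_mat n 1" and C': "?C \<in> carrier_mat 1 n" using B C by auto
  have "?c \<cdot>\<^sub>m (?C * T * ?B) = ?C * (?c \<cdot>\<^sub>m T) * ?B"
    using mult_smult_distrib[OF C' T] mult_smult_assoc_mat[of "?C * T" 1 n ?B 1] B' C' T by simp
  also have "\<dots> = map_mat to_fract (const_mat C * J * const_mat B)"
    unfolding TJ map_ratfun_const
    using to_fract.mat_hom_mult[of "const_mat C" 1 n J n] to_fract.mat_hom_mult[of "const_mat C * J" 1 n "const_mat B" 1]
     B C J by simp
  finally have "(?c \<cdot>\<^sub>m (?C * T * ?B)) $$ (0,0) = to_fract (tf_numerator A B C)"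
    using B C J unfolding tf_numerator_def J_def by simp
  hence *: "?c * (?C * T * ?B) $$ (0,0) = to_fract (tf_numerator A B C)"
    using B' C' T by simp
  have "transfer_function A B C D = (?C * T * ?B) $$ (0,0) + ratfun_const (D $$ (0,0))"
    using A B' C' D T by (simp add: transfer_function_def Let_def T_def[symmetric])
  thus ?thesis using *
    by (simp only: distrib_left ratfun_const_def to_fract_add to_fract_mult mult.commute)
qed

text \<open>With \<open>P = s I - A\<close> and its adjugate \<open>J\<close>, writing
  \<open>A = s I - P\<close> and using \<open>P J = char_poly A * I\<close> gives
  \<open>A J = s J - char_poly A * I\<close>. Sandwiching this between \<open>C\<close> and
  \<open>B\<close> yields a recursion in which the Markov parameter \<open>C B\<close> appears as a
  coefficient.\<close>

lemma tf_numerator_step: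
  assumes A: "A \<in> carrier_mat n n" and B: "B \<in> carrier_mat n 1" and C: "C \<in> carrier_mat 1 n"
  shows "tf_numerator A B (C * A) = [:0, 1:] * tf_numerator A B C - Polynomial.smult ((C * B) $$ (0, 0)) (char_poly A)"
proof -
  let ?P = "char_poly_matrix A" and ?s = "[:0, 1:] :: real poly"
  define J where "J = adj_mat ?P"
  have P: "?P \<in> carrier_mat n n" using A by simp
  have J: "J \<in> carrier_mat n n" unfolding J_def using adj_mat(1)[OF P] .
  have cc: "const_mat A \<in> carrier_mat n n" "const_mat B \<in> carrier_mat n 1" "const_mat C \<in> carrier_mat 1 n"
    using A B C by auto
  have "const_mat A = ?s \<cdot>\<^sub>m 1\<^sub>m n - ?P"
    using A by (intro eq_matI) (auto simp: char_poly_matrix_def)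
  hence "const_mat A * J = (?s \<cdot>\<^sub>m 1\<^sub>m n) * J - ?P * J"
    using minus_mult_distrib_mat[of "?s \<cdot>\<^sub>m 1\<^sub>m n" n n ?P J n] P J by simp
  also have "\<dots> = ?s \<cdot>\<^sub>m J - char_poly A \<cdot>\<^sub>m 1\<^sub>m n"
    unfolding J_def adj_mat(2)[OF P] char_poly_def[symmetric]
    using mult_smult_assoc_mat[OF one_carrier_mat, of J n n ?s] J unfolding J_def by simp
  finally have AJ: "const_mat A * J = ?s \<cdot>\<^sub>m J - char_poly A \<cdot>\<^sub>m 1\<^sub>m n" .
  have "const_mat (C * A) * J * const_mat B = const_mat C * (const_mat A * J) * const_mat B"
    using map_poly_mult(1)[OF C A] cc J by simp
  also have "\<dots> = const_mat C * (?s \<cdot>\<^sub>m J) * const_mat B - const_mat C * (char_poly A \<cdot>\<^sub>m 1\<^sub>m n) * const_mat B"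
    unfolding AJ
    using mult_minus_distrib_mat[OF cc(3), of "?s \<cdot>\<^sub>m J" n "char_poly A \<cdot>\<^sub>m 1\<^sub>m n"] J cc
      minus_mult_distrib_mat[of "const_mat C * (?s \<cdot>\<^sub>m J)" 1 n
        "const_mat C * (char_poly A \<cdot>\<^sub>m 1\<^sub>m n)" "const_mat B" 1]
    by (simp only: smult_carrier_mat mult_carrier_mat one_carrier_mat)
  also have "const_mat C * (?s \<cdot>\<^sub>m J) * const_mat B = ?s \<cdot>\<^sub>m (const_mat C * J * const_mat B)"
    using mult_smult_distrib[OF cc(3) J] mult_smult_assoc_mat[of "const_mat C * J" 1 n "const_mat B" 1] cc J by simp
  also have "const_mat C * (char_poly A \<cdot>\<^sub>m 1\<^sub>m n) * const_mat B = char_poly A \<cdot>\<^sub>m const_mat (C * B)"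
    using mult_smult_distrib[OF cc(3) one_carrier_mat] mult_smult_assoc_mat[of "const_mat C" 1 n "const_mat B" 1]
      map_poly_mult(1)[OF C B] cc by simp
  finally have "const_mat (C * A) * J * const_mat B
    = ?s \<cdot>\<^sub>m (const_mat C * J * const_mat B) - char_poly A \<cdot>\<^sub>m const_mat (C * B)" .
  thus ?thesis unfolding tf_numerator_def J_def[symmetric] using cc J B C
    by (simp add: mult.commute)
qed

text \<open>The entries of the adjugate are, up to sign, minors of size \<open>n - 1\<close> of a
  matrix whose entries have degree at most 1.\<close>

lemma degree_tf_numerator:
  assumes A: "A \<in> carrier_mat n n" and B: "B \<in> carrier_mat n 1" and C: "C \<in> carrier_mat 1 n"
    and n: "0 < n"
  shows "degree (tf_numerator A B C) < n"
proof -
  let ?P = "char_poly_matrix A"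
  have P: "?P \<in> carrier_mat n n" using A by simp
  have J: "adj_mat ?P \<in> carrier_mat n n" using adj_mat(1)[OF P] .
  have ent: "degree (adj_mat ?P $$ (i, j)) \<le> n - 1" if "i < n" "j < n" for i j
  proof -
    have "degree (det (mat_delete ?P j i)) \<le> 1 * (n - 1)"
    proof (rule degree_det_le)
      show "mat_delete ?P j i \<in> carrier_mat (n - 1) (n - 1)" using P by (rule mat_delete_carrier)
      fix a b assume "a < n - 1" "b < n - 1"
      thus "degree (mat_delete ?P j i $$ (a, b)) \<le> 1" using A P
        by (auto simp: mat_delete_def char_poly_matrix_def)
    qed
    thus ?thesis using that P unfolding adj_mat_def cofactor_def
      by (auto simp: minus_one_power_iff)
  qed
  have "tf_numerator A B C = (\<Sum>i<n. Polynomial.smult (C $$ (0, i))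
      (\<Sum>j<n. Polynomial.smult (B $$ (j, 0)) (adj_mat ?P $$ (i, j))))"
    unfolding tf_numerator_def using J B C
    by (simp add: scalar_prod_def atLeast0LessThan)
  also have "degree \<dots> \<le> n - 1"
    by (intro degree_sum_le ballI)
       (auto intro!: order.trans[OF degree_mult_le] order.trans[OF degree_smult_le] degree_sum_le ent[unfolded One_nat_def])
  finally show ?thesis using n by simp
qed

section \<open>The denominator polynomial of the signal model\<close>

definition signal_poly :: "nat \<Rightarrow> (nat \<Rightarrow> real) \<Rightarrow> real poly" where
  "signal_poly k \<omega> = pCons 0 (\<Prod>i=1..k. [:(\<omega> i)\<^sup>2, 0, 1:])"

lemma signal_model_eq: "signal_model k \<omega> = 1 / to_fract (signal_poly k \<omega>)"
proof -
  have *: "ratfun_s ^ 2 + ratfun_const ((\<omega> i)\<^sup>2) = to_fract [:(\<omega> i)\<^sup>2, 0, 1:]" for i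
    unfolding ratfun_s_def ratfun_const_def
    by (simp add: power2_eq_square one_pCons flip: to_fract_add to_fract_mult)
  have "to_fract (signal_poly k \<omega>) = ratfun_s * (\<Prod>i=1..k. to_fract [:(\<omega> i)\<^sup>2, 0, 1:])"
    unfolding signal_poly_def ratfun_s_def
    by (simp flip: to_fract_mult to_fract.hom_prod)
  thus ?thesis unfolding signal_model_def * by (simp add: prod_dividef)
qed

lemma degree_monic_signal_poly:
  "degree (signal_poly k \<omega>) = 2 * k + 1 \<and> coeff (signal_poly k \<omega>) (2 * k + 1) = 1"
proof -
  define p where "p = (\<Prod>i=1..k. [:(\<omega> i)\<^sup>2, 0, 1:])"
  have "lead_coeff p = 1" unfolding p_def lead_coeff_prod by (simp add: one_pCons)
  moreover have "degree p = 2 * k" unfolding p_def by (subst degree_prod_eq_sum_degree) auto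
  ultimately show ?thesis unfolding signal_poly_def p_def[symmetric] by auto
qed

text \<open>The polynomial is \<open>s\<close> times a polynomial in \<open>s^2\<close>, hence odd.
  This later makes the trace of the state matrix vanish.\<close>

lemma coeff_signal_poly_even:
  assumes "even j"
  shows "coeff (signal_poly k \<omega>) j = 0"
proof -
  have "odd j \<Longrightarrow> coeff (\<Prod>i=1..k. [:(\<omega> i)\<^sup>2, 0, 1:]) j = 0" for j
  proof (induction k arbitrary: j)
    case (Suc k)
    have "coeff ([:(\<omega> (Suc k))\<^sup>2, 0, 1:] * q) j = (\<omega> (Suc k))\<^sup>2 * coeff q j + coeff q (j - 2)"
      if "2 \<le> j" for q :: "real poly"
      using that by (auto simp: coeff_pCons numeral_2_eq_2 split: nat.split)
    \<comment> \<open>Index 1 is treated apart: there \<open>j - 2\<close> truncates to 0, and the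
      preceding formula would wrongly add \<open>coeff q 0\<close>.\<close>
    moreover have "coeff ([:(\<omega> (Suc k))\<^sup>2, 0, 1:] * q) 1 = (\<omega> (Suc k))\<^sup>2 * coeff q 1"
      for q :: "real poly" by simp
    ultimately show ?case using Suc
      by (cases "j = 1") (auto simp: mult.commute elim!: oddE)
  qed (auto intro: odd_pos)
  with assms show ?thesis unfolding signal_poly_def by (cases j) auto
qed

section \<open>State dimension and data of a minimal realization\<close>

text \<open>The controllable canonical form realizes \<open>1 / p\<close> with
  \<open>degree p\<close> states, which bounds the dimension of a minimal realization from
  above.\<close>

lemma companion_realization:
  fixes p :: "real poly"
  assumes n: "0 < n" and deg: "degree p = n" and monic: "coeff p n = 1"
  shows "\<exists>A B C D. realization (1 / to_fract p) n A B C D"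
proof -
  define A where "A = mat n n (\<lambda>(i, j).
    (if Suc i = j then 1 else 0) - (if Suc i = n then coeff p j else 0))"
  define B :: "real mat" where "B = mat n 1 (\<lambda>(i, j). if Suc i = n then 1 else 0)"
  define C :: "real mat" where "C = mat 1 n (\<lambda>(i, j). if j = 0 then 1 else 0)"
  \<comment> \<open>The column of powers \<open>1, s, ..., s^(n-1)\<close>. It satisfies
    \<open>(s I - A) X = p B\<close>, so it is \<open>p\<close> times the resolvent applied to
    \<open>B\<close>, and its first entry, selected by \<open>C\<close>, is 1.\<close>
  define X :: "real poly mat" where "X = mat n 1 (\<lambda>(i, j). monom 1 i)"
  let ?P = "char_poly_matrix A"
  have A: "A \<in> carrier_mat n n" and B: "B \<in> carrier_mat n 1" and C: "C \<in> carrier_mat 1 n"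
    and X: "X \<in> carrier_mat n 1"
    by (auto simp: A_def B_def C_def X_def)
  have P: "?P \<in> carrier_mat n n" using A by simp
  note J = adj_mat[OF P, folded char_poly_def]
  have p_eq: "p = monom 1 n + (\<Sum>j<n. monom (coeff p j) j)"
    using poly_as_sum_of_monoms[of p] deg monic by (simp add: lessThan_Suc_atMost[symmetric] add.commute)
  have PX: "?P * X = p \<cdot>\<^sub>m const_mat B"
  proof (intro eq_matI)
    fix i j assume "i < dim_row (p \<cdot>\<^sub>m const_mat B)" "j < dim_col (p \<cdot>\<^sub>m const_mat B)"
    hence i: "i < n" and j: "j = 0" using B by auto
    have "(?P * X) $$ (i, j) = (\<Sum>l<n. ?P $$ (i, l) * monom 1 l)"
      using i j P X by (simp add: scalar_prod_def X_def atLeast0LessThan)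
    also have "\<dots> = (\<Sum>l<n. (if i = l then monom 1 (Suc l) else 0)
      - (if Suc i = l then monom 1 l else 0)
      + (if Suc i = n then monom (coeff p l) l else 0))"
      using i by (intro sum.cong refl)
        (auto simp: char_poly_matrix_def A_def monom_Suc smult_monom distrib_right one_pCons minus_monom)
    also have "\<dots> = monom 1 (Suc i) - (if Suc i < n then monom 1 (Suc i) else 0)
      + (if Suc i = n then \<Sum>l<n. monom (coeff p l) l else 0)"
      using i by (simp add: sum.distrib sum_subtractf)
    also have "\<dots> = (p \<cdot>\<^sub>m const_mat B) $$ (i, j)"
      using i j p_eq B by (auto simp: B_def one_pCons)
    finally show "(?P * X) $$ (i, j) = (p \<cdot>\<^sub>m const_mat B) $$ (i, j)" .
  qed (use B X P in auto)
  have cc: "const_mat B \<in> carrier_mat n 1" "const_mat C \<in> carrier_mat 1 n" using B C by auto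
  have "char_poly A \<cdot>\<^sub>m X = adj_mat ?P * ?P * X"
    unfolding J(3) using mult_smult_assoc_mat[OF one_carrier_mat X] X by simp
  also have "\<dots> = adj_mat ?P * (p \<cdot>\<^sub>m const_mat B)"
    unfolding PX[symmetric] by (rule assoc_mult_mat[OF J(1) P X])
  also have "\<dots> = p \<cdot>\<^sub>m (adj_mat ?P * const_mat B)" by (rule mult_smult_distrib[OF J(1) cc(1)])
  finally have "const_mat C * (char_poly A \<cdot>\<^sub>m X) = const_mat C * (p \<cdot>\<^sub>m (adj_mat ?P * const_mat B))"
    by simp
  hence "char_poly A \<cdot>\<^sub>m (const_mat C * X) = p \<cdot>\<^sub>m (const_mat C * adj_mat ?P * const_mat B)"
    using mult_smult_distrib[OF cc(2) X] assoc_mult_mat[OF cc(2) J(1) cc(1)]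
      mult_smult_distrib[OF cc(2), of "adj_mat ?P * const_mat B" 1] J(1) cc by simp
  hence "(char_poly A \<cdot>\<^sub>m (const_mat C * X)) $$ (0, 0)
    = (p \<cdot>\<^sub>m (const_mat C * adj_mat ?P * const_mat B)) $$ (0, 0)" by simp
  moreover have "(const_mat C * X) $$ (0, 0) = 1"
    using n C X by (simp add: scalar_prod_def C_def X_def sum.remove[of _ 0] one_pCons)
  \<comment> \<open>This identity together with \<open>char_poly A\<close> being nonzero determines
    the transfer function, without computing \<open>char_poly A\<close> itself.\<close>
  ultimately have num: "char_poly A = p * tf_numerator A B C"
    unfolding tf_numerator_def using cc X J(1) by simp
  have "char_poly A \<noteq> 0" using degree_monic_char_poly[OF A] by auto
  moreover have "p \<noteq> 0" using monic by auto
  moreover have "to_fract (char_poly A) * transfer_function A B C (0\<^sub>m 1 1) = to_fract (tf_numerator A B C)"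
    using transfer_function_numerator[OF A B C, of "0\<^sub>m 1 1"] by simp
  ultimately have "transfer_function A B C (0\<^sub>m 1 1) = 1 / to_fract p"
    unfolding num by (simp add: field_simps)
  thus ?thesis using A B C unfolding realization_def by (metis zero_carrier_mat)
qed

text \<open>With \<open>q\<close> the full numerator including the feedthrough, equality of the
  transfer functions reads \<open>char_poly A = q * p\<close>, so \<open>m = degree q + n\<close>.
  The companion form gives \<open>m \<le> n\<close>; hence \<open>q\<close> is constant, and it is 1
  because both other polynomials are monic.\<close>

lemma minimal_realization_inverse_poly:
  fixes p :: "real poly"
  assumes min: "minimal_realization (1 / to_fract p) m A B C D"
    and n: "0 < n" and deg: "degree p = n" and monic: "coeff p n = 1"
  shows "m = n" "char_poly A = p" "tf_numerator A B C = 1" "D $$ (0, 0) = 0"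
proof -
  have A: "A \<in> carrier_mat m m" and B: "B \<in> carrier_mat m 1" and C: "C \<in> carrier_mat 1 m"
    and D: "D \<in> carrier_mat 1 1" and V: "transfer_function A B C D = 1 / to_fract p"
    using min unfolding minimal_realization_def realization_def by auto
  have p0: "p \<noteq> 0" using monic by auto
  define q where "q = tf_numerator A B C + [:D $$ (0, 0):] * char_poly A"
  have chi: "degree (char_poly A) = m" "coeff (char_poly A) m = 1"
    using degree_monic_char_poly[OF A] by auto
  have "to_fract (char_poly A) = to_fract (q * p)"
    using transfer_function_numerator[OF A B C D] p0 unfolding V q_def[symmetric]
    by (simp add: field_simps)
  hence eq: "char_poly A = q * p" by (simp only: to_fract_eq_iff)
  have "q \<noteq> 0" using chi eq by auto
  hence "m = degree q + n" using eq chi deg p0 by (metis degree_mult_eq)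
  moreover have "m \<le> n"
    using companion_realization[OF n deg monic] min unfolding minimal_realization_def by blast
  ultimately have mn: "m = n" and "degree q = 0" by auto
  thus "m = n" by simp
  from \<open>degree q = 0\<close> obtain c where q: "q = [:c:]" by (metis degree_eq_zeroE)
  have "c = 1" using chi eq monic mn q by simp
  thus cp: "char_poly A = p" using eq q by (simp add: one_pCons)
  \<comment> \<open>At index \<open>n\<close> only the feedthrough term of \<open>q\<close> can
    contribute, and it contributes exactly the entry of \<open>D\<close>.\<close>
  have "coeff (tf_numerator A B C) n = 0"
    using degree_tf_numerator[OF A B C] mn n by (simp add: coeff_eq_0)
  moreover have "coeff q n = 0" using q n by (cases n) auto
  ultimately show D0: "D $$ (0, 0) = 0" using monic cp unfolding q_def by simp
  show "tf_numerator A B C = 1" using q \<open>c = 1\<close> D0 unfolding q_def by (simp add: one_pCons)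
qed

section \<open>Markov parameters and the observability matrix\<close>

text \<open>Starting from numerator 1, each step of the recursion multiplies the numerator by
  \<open>s\<close> as long as the Markov parameters vanish, so the numerator belonging to
  \<open>C A^i\<close> is \<open>s^i\<close> for all \<open>i < n\<close>.\<close>

lemma markov_parameters:
  assumes A: "A \<in> carrier_mat n n" and B: "B \<in> carrier_mat n 1" and C: "C \<in> carrier_mat 1 n"
    and num: "tf_numerator A B C = 1" and i: "i < n"
  shows "(C * A ^\<^sub>m i * B) $$ (0, 0) = (if Suc i = n then 1 else 0)"
proof -
  have chi: "coeff (char_poly A) n = 1" using degree_monic_char_poly[OF A] by auto
  have CA: "C * A ^\<^sub>m i \<in> carrier_mat 1 n" for i using A C by auto
  have step: "tf_numerator A B (C * A ^\<^sub>m Suc i) =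
    [:0, 1:] * tf_numerator A B (C * A ^\<^sub>m i) - Polynomial.smult ((C * A ^\<^sub>m i * B) $$ (0, 0)) (char_poly A)" for i
    using tf_numerator_step[OF A B CA, of i] assoc_mult_mat[OF C pow_carrier_mat[OF A] A] by simp
  have deg: "coeff (tf_numerator A B (C * A ^\<^sub>m i)) n = 0" for i
    using degree_tf_numerator[OF A B CA] i by (simp add: coeff_eq_0)
  \<comment> \<open>Comparing coefficients at \<open>n\<close> in \<open>step\<close>: the left side
    has degree below \<open>n\<close> and \<open>char_poly A\<close> is monic, so the Markov
    parameter is the coefficient of \<open>s^(i+1)\<close> at \<open>n\<close>.\<close>
  have markov: "(C * A ^\<^sub>m i * B) $$ (0, 0) = (if Suc i = n then 1 else 0)"
    if "tf_numerator A B (C * A ^\<^sub>m i) = monom 1 i" for i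
    using arg_cong[OF step[of i], of "\<lambda>p. coeff p n"] deg[of "Suc i"] chi
    unfolding that by (simp add: monom_Suc[symmetric])
  have "tf_numerator A B (C * A ^\<^sub>m i) = monom 1 i" using i
  proof (induction i)
    case 0
    thus ?case using num A C by (simp add: one_pCons)
  next
    case (Suc i)
    thus ?case using step[of i] markov[of i] by (simp add: monom_Suc)
  qed
  thus ?thesis by (rule markov)
qed

lemma pow_mat_add:
  assumes A: "A \<in> carrier_mat n n"
  shows "A ^\<^sub>m (i + j) = A ^\<^sub>m i * A ^\<^sub>m j"
proof (induction j)
  case (Suc j)
  thus ?case using assoc_mult_mat[OF pow_carrier_mat[OF A] pow_carrier_mat[OF A] A, of i j] by simp
qed (use pow_carrier_mat[OF A, of i] A in simp)

lemma observability_matrix_index: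
  assumes "A \<in> carrier_mat n n" "C \<in> carrier_mat 1 n"
  shows "observability_matrix n A C \<in> carrier_mat n n"
    "i < n \<Longrightarrow> row (observability_matrix n A C) i = row (C * A ^\<^sub>m i) 0"
  using assms by (auto simp: observability_matrix_def intro!: eq_vecI split: if_splits)

lemma observability_matrix_mult:
  assumes A: "A \<in> carrier_mat n n" and C: "C \<in> carrier_mat 1 n" and M: "M \<in> carrier_mat n l"
    and "i < n" "j < l"
  shows "(observability_matrix n A C * M) $$ (i, j) = (C * A ^\<^sub>m i * M) $$ (0, j)"
  using assms observability_matrix_index[OF A C] by simp

text \<open>The product with a column-reversed controllability matrix is lower triangular with unit
  diagonal, since its entries are Markov parameters.\<close>

lemma det_observability_matrix:
  assumes A: "A \<in> carrier_mat n n" and B: "B \<in> carrier_mat n 1" and C: "C \<in> carrier_mat 1 n"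
    and num: "tf_numerator A B C = 1"
  shows "det (observability_matrix n A C) \<noteq> 0"
proof -
  let ?O = "observability_matrix n A C"
  \<comment> \<open>Reversing the columns makes the exponent \<open>i + (n - 1 - j)\<close> equal to
    \<open>n - 1\<close> on the diagonal and smaller above it.\<close>
  define M where "M = mat n n (\<lambda>(i, j). (A ^\<^sub>m (n - 1 - j) * B) $$ (i, 0))"
  have M: "M \<in> carrier_mat n n" by (simp add: M_def)
  have O: "?O \<in> carrier_mat n n" by (rule observability_matrix_index[OF A C])
  have OM: "(?O * M) $$ (i, j) = (C * A ^\<^sub>m (i + (n - 1 - j)) * B) $$ (0, 0)" if "i < n" "j < n" for i j
  proof -
    have "(?O * M) $$ (i, j) = row (C * A ^\<^sub>m i) 0 \<bullet> col M j"
      using observability_matrix_mult[OF A C M that] A C M that by simp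
    also have "col M j = col (A ^\<^sub>m (n - 1 - j) * B) 0"
      using A B that by (auto simp: M_def intro!: eq_vecI)
    also have "row (C * A ^\<^sub>m i) 0 \<bullet> \<dots> = (C * A ^\<^sub>m i * (A ^\<^sub>m (n - 1 - j) * B)) $$ (0, 0)"
      using A B C by simp
    also have "C * A ^\<^sub>m i * (A ^\<^sub>m (n - 1 - j) * B) = C * A ^\<^sub>m (i + (n - 1 - j)) * B"
      using assoc_mult_mat[of "C * A ^\<^sub>m i" 1 n "A ^\<^sub>m (n - 1 - j)" n B 1]
        assoc_mult_mat[of C 1 n "A ^\<^sub>m i" n "A ^\<^sub>m (n - 1 - j)" n] A B C
      by (simp add: pow_mat_add[OF A])
    finally show ?thesis .
  qed
  have "det (?O * M) = prod_list (diag_mat (?O * M))"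
  proof (rule det_lower_triangular)
    show "?O * M \<in> carrier_mat n n" using O M by simp
    fix i j assume "i < j" "j < n"
    thus "(?O * M) $$ (i, j) = 0" by (subst OM) (auto simp: markov_parameters[OF A B C num])
  qed
  also have "\<dots> = 1"
    unfolding prod_list_diag_prod
    using OM markov_parameters[OF A B C num] O by (intro prod.neutral) auto
  finally show ?thesis using det_mult[OF O M] by auto
qed

section \<open>Exponential stability\<close>

definition mat_trace :: "'a :: comm_monoid_add mat \<Rightarrow> 'a" where
  "mat_trace M = (\<Sum>i<dim_row M. M $$ (i, i))"

text \<open>Rectangular factors are allowed because one application takes the column
  \<open>B\<close> and the row \<open>K\<close>, where the trace collapses to the scalar
  \<open>K B\<close>.\<close>

lemma mat_trace_mult_commute:
  fixes M N :: "'a :: comm_ring_1 mat"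
  assumes M: "M \<in> carrier_mat n l" and N: "N \<in> carrier_mat l n"
  shows "mat_trace (M * N) = mat_trace (N * M)"
proof -
  have "mat_trace (M * N) = (\<Sum>i<n. \<Sum>j<l. M $$ (i, j) * N $$ (j, i))"
    using M N by (simp add: mat_trace_def scalar_prod_def atLeast0LessThan)
  also have "\<dots> = (\<Sum>j<l. \<Sum>i<n. N $$ (j, i) * M $$ (i, j))"
    by (subst sum.swap) (simp add: mult.commute)
  also have "\<dots> = mat_trace (N * M)"
    using M N by (simp add: mat_trace_def scalar_prod_def atLeast0LessThan)
  finally show ?thesis .
qed

lemma complex_triangularization:
  fixes M :: "complex mat"
  assumes M: "M \<in> carrier_mat n n"
  obtains T P Q where "similar_mat_wit M T P Q" "upper_triangular T" "T \<in> carrier_mat n n"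
    "char_poly M = (\<Prod>a\<leftarrow>diag_mat T. [:- a, 1:])"
proof -
  obtain as where as: "char_poly M = (\<Prod>a\<leftarrow>as. [:- a, 1:])"
    using char_poly_factorized[OF M] by blast
  obtain T P Q where "schur_decomposition M as = (T, P, Q)" by (metis prod_cases3)
  from schur_decomposition[OF M as this] have "similar_mat_wit M T P Q" "upper_triangular T"
    "diag_mat T = as" by auto
  moreover from this(1) have "T \<in> carrier_mat n n" using similar_mat_witD2[OF M] by blast
  ultimately show ?thesis using that as by blast
qed

text \<open>Vieta's formula for the second highest coefficient. For the empty list the index would
  truncate to 0, where the coefficient is 1.\<close>

lemma coeff_prod_linear_factors:
  fixes as :: "'a :: idom list"
  assumes "as \<noteq> []"
  shows "coeff (\<Prod>a\<leftarrow>as. [:- a, 1:]) (length as - 1) = - sum_list as"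
  using assms
proof (induction as)
  case (Cons a as)
  show ?case
  proof (cases as)
    case (Cons b bs)
    define p where "p = (\<Prod>a\<leftarrow>as. [:- a, 1:])"
    have "monic p" unfolding p_def by (rule monic_prod_list) auto
    moreover have "degree p = length as" unfolding p_def by (rule degree_linear_factors)
    ultimately have "coeff p (length as) = 1" by simp
    moreover have "coeff p (length as - 1) = - sum_list as"
      using Cons.IH Cons unfolding p_def by simp
    ultimately show ?thesis using Cons unfolding list.map prod_list.Cons p_def[symmetric] by simp
  qed simp
qed simp

lemma mat_trace_triangularization:
  assumes "similar_mat_wit M T P Q" and M: "M \<in> carrier_mat n n" and T: "T \<in> carrier_mat n n"
  shows "mat_trace M = sum_list (diag_mat (T :: complex mat))"
proof -
  from similar_mat_witD2[OF M assms(1)] have PQ: "P \<in> carrier_mat n n" "Q \<in> carrier_mat n n"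
    "Q * P = 1\<^sub>m n" "M = P * T * Q" by auto
  have "mat_trace M = mat_trace (Q * (P * T))"
    unfolding PQ(4) using PQ T by (intro mat_trace_mult_commute[of _ n n]) auto
  also have "Q * (P * T) = T"
    using assoc_mult_mat[OF PQ(2,1) T] PQ T by simp
  also have "mat_trace T = sum_list (diag_mat T)"
    using T by (simp add: mat_trace_def diag_mat_def sum_list_sum_nth atLeast0LessThan)
  finally show ?thesis .
qed

text \<open>Over the complex numbers the matrix is similar to a triangular one whose diagonal lists
  the roots of the characteristic polynomial, so Vieta applies; injectivity of
  \<open>of_real\<close> brings the equation back to the reals.\<close>

lemma coeff_char_poly_trace:
  fixes M :: "real mat"
  assumes M: "M \<in> carrier_mat n n" and n: "0 < n"
  shows "coeff (char_poly M) (n - 1) = - mat_trace M"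
proof -
  let ?M = "map_mat complex_of_real M"
  have M': "?M \<in> carrier_mat n n" using M by simp
  obtain T P Q where T: "similar_mat_wit ?M T P Q" "T \<in> carrier_mat n n"
    "char_poly ?M = (\<Prod>a\<leftarrow>diag_mat T. [:- a, 1:])"
    using complex_triangularization[OF M'] by metis
  have len: "length (diag_mat T) = n" using T(2) by (simp add: diag_mat_def)
  hence "coeff (char_poly ?M) (n - 1) = - mat_trace ?M"
    unfolding T(3) mat_trace_triangularization[OF T(1) M' T(2)]
    using coeff_prod_linear_factors[of "diag_mat T"] n by force
  moreover have "char_poly ?M = map_poly complex_of_real (char_poly M)"
    by (rule of_real_hom.char_poly_hom[OF M])
  moreover have "mat_trace ?M = of_real (mat_trace M)" using M by (simp add: mat_trace_def)
  ultimately have "complex_of_real (coeff (char_poly M) (n - 1)) = of_real (- mat_trace M)"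
    by (simp add: coeff_map_poly)
  thus ?thesis by (simp only: of_real_eq_iff)
qed

text \<open>The diagonal entries of the Schur form are roots of the characteristic polynomial, hence
  eigenvalues.\<close>

lemma hurwitz_triangularization:
  fixes M :: "real mat"
  assumes M: "M \<in> carrier_mat n n" and "hurwitz M"
  obtains T P Q where "similar_mat_wit (map_mat complex_of_real M) T P Q" "upper_triangular T"
    "T \<in> carrier_mat n n" "\<And>i. i < n \<Longrightarrow> Re (T $$ (i, i)) < 0"
proof -
  let ?M = "map_mat complex_of_real M"
  have M': "?M \<in> carrier_mat n n" using M by simp
  obtain T P Q where T: "similar_mat_wit ?M T P Q" "upper_triangular T" "T \<in> carrier_mat n n"
    "char_poly ?M = (\<Prod>a\<leftarrow>diag_mat T. [:- a, 1:])"
    using complex_triangularization[OF M'] by metis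
  have "Re (T $$ (i, i)) < 0" if "i < n" for i
  proof -
    have "T $$ (i, i) \<in> set (diag_mat T)" using that T(3) by (auto simp: diag_mat_def)
    hence "poly (char_poly ?M) (T $$ (i, i)) = 0"
      unfolding T(4) by (auto simp: poly_prod_list prod_list_zero_iff)
    thus ?thesis using \<open>hurwitz M\<close> eigenvalue_root_char_poly[OF M'] unfolding hurwitz_def by blast
  qed
  with T show ?thesis using that by blast
qed

lemma hurwitz_trace_neg:
  fixes M :: "real mat"
  assumes M: "M \<in> carrier_mat n n" and "hurwitz M" and n: "0 < n"
  shows "mat_trace M < 0"
proof -
  obtain T P Q where T: "similar_mat_wit (map_mat complex_of_real M) T P Q"
    "T \<in> carrier_mat n n" "\<And>i. i < n \<Longrightarrow> Re (T $$ (i, i)) < 0"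
    using hurwitz_triangularization[OF M \<open>hurwitz M\<close>] by metis
  have "complex_of_real (mat_trace M) = mat_trace (map_mat complex_of_real M)"
    using M by (simp add: mat_trace_def)
  also have "\<dots> = (\<Sum>i<n. T $$ (i, i))"
    using mat_trace_triangularization[OF T(1) _ T(2)] M T(2)
    by (simp add: diag_mat_def sum_list_sum_nth atLeast0LessThan)
  finally have "mat_trace M = (\<Sum>i<n. Re (T $$ (i, i)))"
    by (metis Re_complex_of_real Re_sum)
  also have "\<dots> < (\<Sum>i<n. 0)" using n T(3) by (intro sum_strict_mono) auto
  finally show ?thesis by simp
qed

section \<open>Exponentially decaying functions and linear differential equations\<close>

text \<open>Only the half-line matters, matching the time axis of the trajectories. No sign is
  imposed on \<open>M\<close>; the bound at \<open>t = 0\<close> already forces it to be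
  nonnegative.\<close>

definition exp_bounded :: "(real \<Rightarrow> 'a :: real_normed_vector) \<Rightarrow> bool" where
  "exp_bounded g \<longleftrightarrow> (\<exists>M a. a > 0 \<and> (\<forall>t\<ge>0. norm (g t) \<le> M * exp (- a * t)))"

text \<open>A decay rate may always be lowered, here below a prescribed \<open>b\<close>, which
  orders the rates of two functions or keeps a rate away from that of an eigenvalue.\<close>

lemma exp_bounded_obtain:
  assumes "exp_bounded g" "0 < b"
  obtains M a where "0 < a" "a < b" "0 \<le> M" "\<And>t. 0 \<le> t \<Longrightarrow> norm (g t) \<le> M * exp (- a * t)"
proof -
  from assms(1) obtain M c where c: "0 < c" "\<And>t. 0 \<le> t \<Longrightarrow> norm (g t) \<le> M * exp (- c * t)"
    unfolding exp_bounded_def by blast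
  have M: "0 \<le> M" using c(2)[of 0] norm_ge_zero[of "g 0"] by (simp del: norm_ge_zero)
  define a where "a = min c (b / 2)"
  have "norm (g t) \<le> M * exp (- a * t)" if "0 \<le> t" for t
  proof -
    have "a * t \<le> c * t" using that by (intro mult_right_mono) (auto simp: a_def)
    hence "M * exp (- c * t) \<le> M * exp (- a * t)" using M by (intro mult_left_mono) auto
    with c(2)[OF that] show ?thesis by simp
  qed
  moreover have "0 < a" "a < b" using c(1) assms(2) by (auto simp: a_def)
  ultimately show ?thesis using M that by blast
qed

lemma exp_bounded_add:
  assumes "exp_bounded f" "exp_bounded g"
  shows "exp_bounded (\<lambda>t. f t + g t)"
proof -
  from assms(1) obtain M a where f: "0 < a" "0 \<le> M" "\<And>t. 0 \<le> t \<Longrightarrow> norm (f t) \<le> M * exp (- a * t)"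
    by (rule exp_bounded_obtain[of _ 1]) auto
  from assms(2) f(1) obtain N b where g: "0 < b" "b < a" "0 \<le> N"
    "\<And>t. 0 \<le> t \<Longrightarrow> norm (g t) \<le> N * exp (- b * t)"
    by (rule exp_bounded_obtain) auto
  have "norm (f t + g t) \<le> (M + N) * exp (- b * t)" if "0 \<le> t" for t
  proof -
    have "b * t \<le> a * t" using g(2) that by (intro mult_right_mono) auto
    hence "M * exp (- a * t) \<le> M * exp (- b * t)" using f(2) by (intro mult_left_mono) auto
    thus ?thesis using f(3)[OF that] g(4)[OF that] norm_triangle_ineq[of "f t" "g t"]
      by (simp add: distrib_right)
  qed
  thus ?thesis unfolding exp_bounded_def using g(1) by blast
qed

lemma exp_bounded_mult:
  fixes f g :: "real \<Rightarrow> 'a :: real_normed_algebra"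
  assumes "exp_bounded f" "exp_bounded g"
  shows "exp_bounded (\<lambda>t. f t * g t)"
proof -
  from assms(1) obtain M a where f: "0 < a" "0 \<le> M" "\<And>t. 0 \<le> t \<Longrightarrow> norm (f t) \<le> M * exp (- a * t)"
    by (rule exp_bounded_obtain[of _ 1]) auto
  from assms(2) obtain N b where g: "0 < b" "0 \<le> N"
    "\<And>t. 0 \<le> t \<Longrightarrow> norm (g t) \<le> N * exp (- b * t)"
    by (rule exp_bounded_obtain[of _ 1]) auto
  have "norm (f t * g t) \<le> (M * N) * exp (- (a + b) * t)" if "0 \<le> t" for t
  proof -
    have "norm (f t * g t) \<le> (M * exp (- a * t)) * (N * exp (- b * t))"
      using norm_mult_ineq[of "f t" "g t"] mult_mono[OF f(3)[OF that] g(3)[OF that]] f(2)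
      by (auto intro: order.trans)
    thus ?thesis by (simp add: exp_add[symmetric] algebra_simps)
  qed
  thus ?thesis unfolding exp_bounded_def using f(1) g(1) by (meson add_pos_pos)
qed

lemma exp_bounded_const_mult:
  fixes f :: "real \<Rightarrow> 'a :: real_normed_algebra"
  assumes "exp_bounded f"
  shows "exp_bounded (\<lambda>t. c * f t)"
proof -
  from assms obtain M a where f: "0 < a" "\<And>t. 0 \<le> t \<Longrightarrow> norm (f t) \<le> M * exp (- a * t)"
    unfolding exp_bounded_def by blast
  have "norm (c * f t) \<le> (norm c * M) * exp (- a * t)" if "0 \<le> t" for t
    using norm_mult_ineq[of c "f t"] mult_left_mono[OF f(2)[OF that], of "norm c"]
    by (simp add: mult.assoc)
  thus ?thesis unfolding exp_bounded_def using f(1) by blast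
qed

lemma exp_bounded_sum:
  fixes f :: "'i \<Rightarrow> real \<Rightarrow> 'a :: real_normed_vector"
  assumes "\<And>i. i \<in> I \<Longrightarrow> exp_bounded (f i)"
  shows "exp_bounded (\<lambda>t. \<Sum>i\<in>I. f i t)"
proof -
  have zero: "exp_bounded (\<lambda>t. 0 :: 'a)" unfolding exp_bounded_def by (intro exI[of _ 1]) auto
  show ?thesis using assms
    by (induction I rule: infinite_finite_induct) (auto intro: zero exp_bounded_add)
qed

text \<open>Variation of constants: the integrating factor \<open>exp (- l t)\<close> removes the
  homogeneous part, the remaining derivative is bounded by a growing exponential, and multiplying
  back gives decay at the rate of the forcing.\<close>

lemma exp_bounded_linear_ode:
  fixes h f :: "real \<Rightarrow> complex"
  assumes der: "\<And>t. 0 \<le> t \<Longrightarrow> (h has_vector_derivative l * h t + f t) (at t within {0..})"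
    and l: "Re l < 0" and f: "exp_bounded f"
  shows "exp_bounded h"
proof -
  obtain M a where a: "0 < a" "a < - Re l" "0 \<le> M"
    "\<And>t. 0 \<le> t \<Longrightarrow> norm (f t) \<le> M * exp (- a * t)"
    by (rule exp_bounded_obtain[OF f, of "- Re l"]) (use l in auto)
  \<comment> \<open>The rate \<open>a\<close> was chosen strictly below \<open>- Re l\<close>, so
    \<open>c\<close> is positive; in the resonant case \<open>c = 0\<close> the integral would grow
    linearly in \<open>t\<close>.\<close>
  define c where "c = - Re l - a"
  have c: "0 < c" using a(2) by (simp add: c_def)
  define g where "g t = h t * exp (- l * of_real t)" for t
  have g': "(g has_vector_derivative f t * exp (- l * of_real t)) (at t within {0..})"
    if "0 \<le> t" for t
    unfolding g_def
    by (rule derivative_eq_intros der[OF that] has_vector_derivative_real_field | simp)+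
       (simp add: algebra_simps)
  have "norm (h t) \<le> (norm (h 0) + M / c) * exp (- a * t)" if t: "0 \<le> t" for t
  proof -
    \<comment> \<open>Mean value inequality: \<open>norm (g')\<close> is at most
      \<open>M * exp (c * t)\<close>, the derivative of \<open>M / c * exp (c * t)\<close>.\<close>
    have "norm (g t - g 0) \<le> M / c * exp (c * t) - M / c * exp (c * 0)"
    proof (cases "t = 0")
      case False
      hence "0 < t" using t by simp
      moreover have "continuous_on {0..t} g"
        using has_vector_derivative_within_subset[OF g']
        by (intro continuous_on_vector_derivative[where f' = "\<lambda>t. f t * exp (- l * of_real t)"]) auto
      moreover have "continuous_on {0..t} (\<lambda>t. M / c * exp (c * t))" by (intro continuous_intros)
      ultimately show ?thesis
      proof (rule differentiable_bound_general[where f' = "\<lambda>t. f t * exp (- l * of_real t)"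
          and \<phi>' = "\<lambda>t. M * exp (c * t)"])
        fix s assume s: "0 < s" "s < t"
        show "(g has_vector_derivative f s * exp (- l * of_real s)) (at s)"
          using g'[of s] s by (simp add: at_within_interior[of s "{0..}"])
        show "((\<lambda>t. M / c * exp (c * t)) has_vector_derivative M * exp (c * s)) (at s)"
          using c by (auto intro!: derivative_eq_intros simp: has_real_derivative_iff_has_vector_derivative[symmetric])
        have "norm (f s * exp (- l * of_real s)) \<le> M * exp (- a * s) * exp (- Re l * s)"
          using a(4)[of s] s by (simp add: norm_mult mult_right_mono)
        moreover have "- a * s + - Re l * s = c * s" by (simp add: c_def algebra_simps)
        hence "exp (- a * s) * exp (- Re l * s) = exp (c * s)" by (simp only: exp_add[symmetric])
        ultimately show "norm (f s * exp (- l * of_real s)) \<le> M * exp (c * s)"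
          by (simp only: mult.assoc)
      qed
    qed simp
    moreover have "norm (g t) \<le> norm (g t - g 0) + norm (g 0)" by (metis diff_add_cancel norm_triangle_ineq)
    moreover have "0 \<le> M / c" using a(3) c by simp
    ultimately have "norm (g t) \<le> norm (h 0) + M / c * exp (c * t)" by (simp add: g_def)
    also have "\<dots> \<le> norm (h 0) * exp (c * t) + M / c * exp (c * t)"
      using c t mult_left_mono[of 1 "exp (c * t)" "norm (h 0)"] by simp
    finally have g: "norm (g t) \<le> (norm (h 0) + M / c) * exp (c * t)" by (simp add: distrib_right)
    have "norm (h t) = norm (g t) * exp (Re l * t)"
      by (simp add: g_def norm_mult mult.assoc exp_add[symmetric])
    also have "\<dots> \<le> (norm (h 0) + M / c) * exp (c * t) * exp (Re l * t)"
      using g by (rule mult_right_mono) simp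
    also have "\<dots> = (norm (h 0) + M / c) * exp (- a * t)"
      by (simp add: c_def mult.assoc exp_add[symmetric] algebra_simps)
    finally show ?thesis .
  qed
  thus ?thesis unfolding exp_bounded_def using a(1) by blast
qed

text \<open>In the coordinates \<open>Q x\<close> of the Schur form the system is upper triangular,
  so each component solves a scalar equation with a stable coefficient and a decaying forcing term.
  The decay carries over to \<open>x\<close> by applying \<open>P\<close>.\<close>

lemma exp_bounded_hurwitz:
  fixes M :: "real mat" and x :: "real \<Rightarrow> real vec"
  assumes M: "M \<in> carrier_mat n n" and "hurwitz M"
    and x: "\<And>t. 0 \<le> t \<Longrightarrow> x t \<in> carrier_vec n"
    and der: "\<And>t i. 0 \<le> t \<Longrightarrow> i < n \<Longrightarrow>
      ((\<lambda>\<tau>. x \<tau> $ i) has_real_derivative (M *\<^sub>v x t) $ i) (at t within {0..})"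
    and i: "i < n"
  shows "exp_bounded (\<lambda>t. x t $ i)"
proof -
  let ?M = "map_mat complex_of_real M"
  obtain T P Q where T: "similar_mat_wit ?M T P Q" "upper_triangular T"
    "T \<in> carrier_mat n n" "\<And>i. i < n \<Longrightarrow> Re (T $$ (i, i)) < 0"
    using hurwitz_triangularization[OF M \<open>hurwitz M\<close>] by metis
  have M': "?M \<in> carrier_mat n n" using M by simp
  from similar_mat_witD2[OF M' T(1)] have PQ: "P \<in> carrier_mat n n" "Q \<in> carrier_mat n n"
    "P * Q = 1\<^sub>m n" "Q * P = 1\<^sub>m n" "?M = P * T * Q" by auto
  have QM: "Q * ?M = T * Q"
    using assoc_mult_mat[OF PQ(2) mult_carrier_mat[OF PQ(1) T(3)] PQ(2)]
      assoc_mult_mat[OF PQ(2) PQ(1) T(3)] PQ T(3) by simp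
  define xc where "xc t = map_vec complex_of_real (x t)" for t
  define z where "z t = Q *\<^sub>v xc t" for t
  have xc: "xc t \<in> carrier_vec n" if "0 \<le> t" for t using x[OF that] by (simp add: xc_def)
  have z: "z t \<in> carrier_vec n" if "0 \<le> t" for t using xc[OF that] PQ(2) by (simp add: z_def)
  have zi: "z t $ i = (\<Sum>j<n. Q $$ (i, j) * of_real (x t $ j))" if "i < n" "0 \<le> t" for i t
    using that PQ(2) x[of t] by (simp add: z_def xc_def scalar_prod_def atLeast0LessThan)
  have Tz: "T *\<^sub>v z t = Q *\<^sub>v map_vec complex_of_real (M *\<^sub>v x t)" if "0 \<le> t" for t
  proof -
    have "T *\<^sub>v z t = (T * Q) *\<^sub>v xc t" unfolding z_def using T(3) PQ(2) xc[OF that] by simp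
    also have "\<dots> = Q *\<^sub>v (?M *\<^sub>v xc t)"
      unfolding QM[symmetric] using PQ(2) M' xc[OF that] by (rule assoc_mult_mat_vec)
    also have "?M *\<^sub>v xc t = map_vec complex_of_real (M *\<^sub>v x t)"
      unfolding xc_def by (rule of_real_hom.mult_mat_vec_hom[OF M x[OF that], symmetric])
    finally show ?thesis .
  qed
  have z': "((\<lambda>\<tau>. z \<tau> $ i) has_vector_derivative (T *\<^sub>v z t) $ i) (at t within {0..})"
    if "i < n" "0 \<le> t" for i t
  proof -
    have "((\<lambda>\<tau>. \<Sum>j<n. Q $$ (i, j) * of_real (x \<tau> $ j)) has_vector_derivative
       (\<Sum>j<n. Q $$ (i, j) * of_real ((M *\<^sub>v x t) $ j))) (at t within {0..})"
      using der[OF that(2)]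
      by (intro has_vector_derivative_sum has_vector_derivative_mult_right has_vector_derivative_of_real)
         (simp add: has_real_derivative_iff_has_vector_derivative)
    also have "(\<Sum>j<n. Q $$ (i, j) * of_real ((M *\<^sub>v x t) $ j)) = (T *\<^sub>v z t) $ i"
      unfolding Tz[OF that(2)] using that PQ(2) M x[OF that(2)]
      by (simp add: scalar_prod_def[of _ "map_vec _ _"] atLeast0LessThan)
    finally show ?thesis
      by (rule has_vector_derivative_transform[rotated 2]) (use that zi in simp_all)
  qed
  \<comment> \<open>Back substitution: the i-th equation is driven only by components of larger index.\<close>
  have zb: "i < n \<Longrightarrow> exp_bounded (\<lambda>t. z t $ i)" for i
  proof (induction "n - i" arbitrary: i rule: less_induct)
    case less
    define f where "f t = (\<Sum>j\<in>{Suc i..<n}. T $$ (i, j) * z t $ j)" for t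
    have "exp_bounded (\<lambda>t. z t $ j)" if "j \<in> {Suc i..<n}" for j
      using that less.prems by (intro less.hyps) auto
    hence f: "exp_bounded f"
      unfolding f_def by (intro exp_bounded_sum exp_bounded_const_mult)
    have split: "(T *\<^sub>v z t) $ i = T $$ (i, i) * z t $ i + f t" if "0 \<le> t" for t
    proof -
      have "(T *\<^sub>v z t) $ i = (\<Sum>j\<in>{0..<n}. T $$ (i, j) * z t $ j)"
        using T(3) z[OF that] less.prems by (simp add: scalar_prod_def)
      also have "{0..<n} = {0..<i} \<union> {i..<n}" using less.prems by auto
      also have "(\<Sum>j\<in>\<dots>. T $$ (i, j) * z t $ j)
        = (\<Sum>j\<in>{0..<i}. T $$ (i, j) * z t $ j) + (\<Sum>j\<in>{i..<n}. T $$ (i, j) * z t $ j)"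
        by (rule sum.union_disjoint) auto
      also have "(\<Sum>j\<in>{0..<i}. T $$ (i, j) * z t $ j) = 0"
        using T(2,3) less.prems by (intro sum.neutral) (auto simp: upper_triangular_def)
      also have "(\<Sum>j\<in>{i..<n}. T $$ (i, j) * z t $ j) = T $$ (i, i) * z t $ i + f t"
        unfolding f_def using less.prems by (simp add: sum.atLeast_Suc_lessThan)
      finally show ?thesis by simp
    qed
    show ?case
    proof (rule exp_bounded_linear_ode[OF _ T(4)[OF less.prems] f])
      fix t :: real assume t: "0 \<le> t"
      show "((\<lambda>\<tau>. z \<tau> $ i) has_vector_derivative T $$ (i, i) * z t $ i + f t) (at t within {0..})"
        using z'[OF less.prems t] unfolding split[OF t] .
    qed
  qed
  have xi: "complex_of_real (x t $ i) = (\<Sum>j<n. P $$ (i, j) * z t $ j)" if "0 \<le> t" for t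
  proof -
    have "P *\<^sub>v z t = xc t"
      unfolding z_def using assoc_mult_mat_vec[OF PQ(1,2) xc[OF that]] PQ(3) xc[OF that] by simp
    hence "xc t $ i = (P *\<^sub>v z t) $ i" by simp
    thus ?thesis using PQ(1) z[OF that] i x[OF that]
      by (simp add: xc_def scalar_prod_def atLeast0LessThan)
  qed
  have "exp_bounded (\<lambda>t. \<Sum>j<n. P $$ (i, j) * z t $ j)"
    using zb by (intro exp_bounded_sum exp_bounded_const_mult) auto
  moreover have "norm (x t $ i) = norm (\<Sum>j<n. P $$ (i, j) * z t $ j)" if "0 \<le> t" for t
    by (simp only: xi[OF that, symmetric] norm_of_real real_norm_def)
  ultimately show ?thesis unfolding exp_bounded_def by simp
qed

lemma nn_integral_exp_bounded:
  assumes "exp_bounded (g :: real \<Rightarrow> real)"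
  shows "(\<integral>\<^sup>+ t\<in>{0..}. ennreal (g t) \<partial>lborel) < \<infinity>"
proof -
  from assms obtain M a where a: "0 < a" "0 \<le> M" "\<And>t. 0 \<le> t \<Longrightarrow> norm (g t) \<le> M * exp (- a * t)"
    by (rule exp_bounded_obtain[of _ 1]) auto
  have "(\<integral>\<^sup>+ t\<in>{0..}. ennreal (g t) \<partial>lborel) \<le> (\<integral>\<^sup>+ t\<in>{0..}. ennreal (M * exp (- a * t)) \<partial>lborel)"
    using a(3) by (intro nn_integral_mono)
      (auto intro!: ennreal_leI simp: abs_le_iff split: split_indicator)
  also have "\<dots> = ennreal (0 - (- M / a) * exp (- a * 0))"
  proof (rule nn_integral_FTC_atLeast)
    fix t :: real
    show "((\<lambda>t. (- M / a) * exp (- a * t)) has_real_derivative M * exp (- a * t)) (at t)"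
      using a(1) by (auto intro!: derivative_eq_intros)
    show "((\<lambda>t. (- M / a) * exp (- a * t)) \<longlongrightarrow> 0) at_top"
      using a(1) by real_asymp
  qed (use a in auto)
  finally show ?thesis by (rule order.strict_trans1) simp
qed

section \<open>Uniqueness of the optimal input\<close>

text \<open>The double sum lets decay, continuity and the parallelogram identity be checked term by
  term.\<close>

lemma scalar_prod_mult_mat_vec:
  fixes Q :: "real mat"
  assumes "Q \<in> carrier_mat n n" "v \<in> carrier_vec n"
  shows "v \<bullet> (Q *\<^sub>v v) = (\<Sum>i<n. \<Sum>j<n. Q $$ (i, j) * (v $ i * v $ j))"
  using assms
  by (simp add: scalar_prod_def atLeast0LessThan sum_distrib_left algebra_simps)

lemma state_responseD:
  fixes x :: "real \<Rightarrow> real vec"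
  assumes "state_response A B x0 u x" and A: "A \<in> carrier_mat n n"
  shows "continuous_on {0..} u" "x 0 = x0" "\<And>t. 0 \<le> t \<Longrightarrow> x t \<in> carrier_vec n"
    "\<And>t i. 0 \<le> t \<Longrightarrow> i < n \<Longrightarrow> ((\<lambda>\<tau>. x \<tau> $ i) has_real_derivative
       (A *\<^sub>v x t + u t \<cdot>\<^sub>v col B 0) $ i) (at t within {0..})"
    "\<And>i. i < n \<Longrightarrow> continuous_on {0..} (\<lambda>t. x t $ i)"
proof -
  show 1: "continuous_on {0..} u" "x 0 = x0" "\<And>t. 0 \<le> t \<Longrightarrow> x t \<in> carrier_vec n"
    "\<And>t i. 0 \<le> t \<Longrightarrow> i < n \<Longrightarrow> ((\<lambda>\<tau>. x \<tau> $ i) has_real_derivative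
       (A *\<^sub>v x t + u t \<cdot>\<^sub>v col B 0) $ i) (at t within {0..})"
    using assms unfolding state_response_def by auto
  show "continuous_on {0..} (\<lambda>t. x t $ i)" if "i < n" for i
    by (rule DERIV_continuous_on[OF 1(4)]) (use that in auto)
qed

text \<open>Under the feedback the state solves \<open>x' = (A - B K) x\<close> and decays
  exponentially, and so does the integrand. Finiteness is what permits cancelling the optimal cost
  in the uniqueness argument.\<close>

lemma quadratic_cost_finite:
  fixes A B K Q :: "real mat" and x :: "real \<Rightarrow> real vec"
  assumes A: "A \<in> carrier_mat n n" and B: "B \<in> carrier_mat n 1" and K: "K \<in> carrier_mat 1 n"
    and Q: "Q \<in> carrier_mat n n" and hur: "hurwitz (A - B * K)"
    and x: "state_response A B x0 u x" and u: "\<And>t. 0 \<le> t \<Longrightarrow> u t = - (row K 0 \<bullet> x t)"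
  shows "quadratic_cost Q R x u < \<infinity>"
proof -
  note sr = state_responseD[OF x A]
  have AK: "A - B * K \<in> carrier_mat n n" using A B K by auto
  have xb: "exp_bounded (\<lambda>t. x t $ i)" if "i < n" for i
  proof (rule exp_bounded_hurwitz[OF AK hur sr(3) _ that])
    fix t :: real and i assume t: "0 \<le> t" and i: "i < n"
    have "(A - B * K) *\<^sub>v x t = A *\<^sub>v x t - B *\<^sub>v (K *\<^sub>v x t)"
      using minus_mult_distrib_mat_vec[OF A _ sr(3)[OF t], of "B * K"] B K sr(3)[OF t] by simp
    also have "K *\<^sub>v x t = vec 1 (\<lambda>_. - u t)"
      using K sr(3)[OF t] u[OF t] by (intro eq_vecI) auto
    also have "A *\<^sub>v x t - B *\<^sub>v vec 1 (\<lambda>_. - u t) = A *\<^sub>v x t + u t \<cdot>\<^sub>v col B 0"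
      using A B by (intro eq_vecI) (auto simp: scalar_prod_def)
    finally show "((\<lambda>\<tau>. x \<tau> $ i) has_real_derivative ((A - B * K) *\<^sub>v x t) $ i) (at t within {0..})"
      using sr(4)[OF t i] by simp
  qed
  \<comment> \<open>The feedback law as a linear combination of state components, so that the
    closure properties of \<open>exp_bounded\<close> apply; it agrees with \<open>u\<close> on the
    half-line.\<close>
  define w where "w t = (\<Sum>i<n. - K $$ (0, i) * x t $ i)" for t
  have w: "u t = w t" if "0 \<le> t" for t
    using u[OF that] K sr(3)[OF that]
    by (simp add: w_def scalar_prod_def atLeast0LessThan sum_negf)
  define g where "g t = (\<Sum>i<n. \<Sum>j<n. Q $$ (i, j) * (x t $ i * x t $ j)) + R * (w t * w t)" for t
  have "exp_bounded w" unfolding w_def by (intro exp_bounded_sum exp_bounded_const_mult xb) auto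
  hence "exp_bounded g" unfolding g_def
    by (intro exp_bounded_add exp_bounded_sum exp_bounded_const_mult exp_bounded_mult xb) auto
  moreover have "quadratic_cost Q R x u = (\<integral>\<^sup>+ t\<in>{0..}. ennreal (g t) \<partial>lborel)"
    unfolding quadratic_cost_def
    by (intro nn_integral_cong)
       (auto simp: g_def w scalar_prod_mult_mat_vec[OF Q sr(3)] ac_simps split: split_indicator)
  ultimately show ?thesis using nn_integral_exp_bounded by simp
qed

text \<open>
  The parallelogram identity for the quadratic cost turns a second optimal input into a
  vanishing cost of the difference, hence (the inputs being continuous) into equality.
\<close>

lemma optimal_input_unique:
  fixes A B Q :: "real mat" and x y :: "real \<Rightarrow> real vec"
  assumes A: "A \<in> carrier_mat n n" and B: "B \<in> carrier_mat n 1" and Q: "pos_semidef n Q"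
    and R: "R > 0"
    and x: "state_response A B x0 u x" and y: "state_response A B x0 v y"
    and opt: "\<And>x' u'. state_response A B x0 u' x' \<Longrightarrow> quadratic_cost Q R x u \<le> quadratic_cost Q R x' u'"
    and fin: "quadratic_cost Q R x u < \<infinity>" and le: "quadratic_cost Q R y v \<le> quadratic_cost Q R x u"
  shows "u 0 = v 0"
proof -
  note sx = state_responseD[OF x A] and sy = state_responseD[OF y A]
  have Qc: "Q \<in> carrier_mat n n" and Qp: "\<And>a. a \<in> carrier_vec n \<Longrightarrow> 0 \<le> a \<bullet> (Q *\<^sub>v a)"
    using Q by (auto simp: pos_semidef_def)
  define q where "q a r = (\<Sum>i<n. \<Sum>j<n. Q $$ (i, j) * (a $ i * a $ j)) + R * (r * r)"
    for a :: "real vec" and r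
  \<comment> \<open>The quadratic cost with the indicator moved inside \<open>ennreal\<close>, the
    form in which continuity on the half-line gives measurability.\<close>
  define cost where "cost X U = (\<integral>\<^sup>+ t. ennreal (indicator {0..} t *\<^sub>R q (X t) (U t)) \<partial>lborel)"
    for X :: "real \<Rightarrow> real vec" and U
  have qc: "quadratic_cost Q R X U = cost X U" if "\<And>t. 0 \<le> t \<Longrightarrow> X t \<in> carrier_vec n" for X U
    unfolding quadratic_cost_def cost_def
    by (intro nn_integral_cong)
       (auto simp: q_def scalar_prod_mult_mat_vec[OF Qc that] ac_simps split: split_indicator)
  have q_ge: "R * (r * r) \<le> q a r" if "a \<in> carrier_vec n" for a r
    using Qp[OF that] scalar_prod_mult_mat_vec[OF Qc that] by (simp add: q_def)
  have q0: "0 \<le> q a r" if "a \<in> carrier_vec n" for a r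
    using q_ge[OF that, of r] R by (meson mult_nonneg_nonneg zero_le_square less_imp_le order.trans)
  have meas: "(\<lambda>t. ennreal (indicator {0..} t *\<^sub>R q (X t) (U t))) \<in> borel_measurable lborel"
    if "continuous_on {0..} U" "\<And>i. i < n \<Longrightarrow> continuous_on {0..} (\<lambda>t. X t $ i)"
    for X :: "real \<Rightarrow> real vec" and U
  proof -
    have "continuous_on {0..} (\<lambda>t. q (X t) (U t))"
      unfolding q_def using that by (intro continuous_intros) auto
    hence "(\<lambda>t. indicator {0..} t *\<^sub>R q (X t) (U t)) \<in> borel_measurable borel"
      by (intro borel_measurable_continuous_on_indicator) auto
    thus ?thesis by simp
  qed
  \<comment> \<open>The midpoint \<open>z\<close>, \<open>w\<close> is again an admissible
    trajectory from \<open>x0\<close>, hence a competitor; of the half difference \<open>d\<close>,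
    \<open>e\<close> only the cost is used.\<close>
  define z where "z t = (1/2) \<cdot>\<^sub>v (x t + y t)" for t
  define w where "w t = (u t + v t) / 2" for t
  define d where "d t = (1/2) \<cdot>\<^sub>v (x t - y t)" for t
  define e where "e t = (u t - v t) / 2" for t
  have zc: "z t \<in> carrier_vec n" and dc: "d t \<in> carrier_vec n" if "0 \<le> t" for t
    using sx(3)[OF that] sy(3)[OF that] by (auto simp: z_def d_def)
  have zi: "z t $ i = (x t $ i + y t $ i) / 2" and di: "d t $ i = (x t $ i - y t $ i) / 2"
    if "0 \<le> t" "i < n" for t i
    using sx(3)[OF that(1)] sy(3)[OF that(1)] that(2) by (auto simp: z_def d_def)
  have cont: "continuous_on {0..} w" "continuous_on {0..} e"
    unfolding w_def e_def by (intro continuous_intros sx(1) sy(1); simp)+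
  have zcont: "continuous_on {0..} (\<lambda>t. z t $ i)" and dcont: "continuous_on {0..} (\<lambda>t. d t $ i)"
    if "i < n" for i
  proof -
    have c: "continuous_on {0..} (\<lambda>t. (x t $ i + y t $ i) / 2)"
      "continuous_on {0..} (\<lambda>t. (x t $ i - y t $ i) / 2)"
      by (intro continuous_intros sx(5)[OF that] sy(5)[OF that]; simp)+
    show "continuous_on {0..} (\<lambda>t. z t $ i)"
      by (rule continuous_on_eq[OF c(1)]) (use zi that in simp)
    show "continuous_on {0..} (\<lambda>t. d t $ i)"
      by (rule continuous_on_eq[OF c(2)]) (use di that in simp)
  qed
  have z: "state_response A B x0 w z"
    unfolding state_response_def
  proof (intro conjI allI impI)
    have "x0 \<in> carrier_vec n" using sx(2) sx(3)[of 0] by simp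
    thus "z 0 = x0" using sx(2) sy(2) by (intro eq_vecI) (auto simp: z_def)
    fix t :: real assume t: "0 \<le> t"
    show "z t \<in> carrier_vec (dim_row A)" using zc[OF t] A by simp
    fix i assume "i < dim_row A"
    hence i: "i < n" using A by simp
    have "((\<lambda>\<tau>. (x \<tau> $ i + y \<tau> $ i) / 2) has_real_derivative
      ((A *\<^sub>v x t + u t \<cdot>\<^sub>v col B 0) $ i + (A *\<^sub>v y t + v t \<cdot>\<^sub>v col B 0) $ i) / 2) (at t within {0..})"
      by (intro DERIV_cdivide DERIV_add sx(4)[OF t i] sy(4)[OF t i])
    moreover have "((A *\<^sub>v x t + u t \<cdot>\<^sub>v col B 0) $ i + (A *\<^sub>v y t + v t \<cdot>\<^sub>v col B 0) $ i) / 2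
      = (A *\<^sub>v z t + w t \<cdot>\<^sub>v col B 0) $ i"
    proof -
      have "A *\<^sub>v z t = (1/2) \<cdot>\<^sub>v (A *\<^sub>v x t + A *\<^sub>v y t)"
        unfolding z_def using A sx(3)[OF t] sy(3)[OF t]
        by (simp add: mult_mat_vec mult_add_distrib_mat_vec)
      thus ?thesis using A B sx(3)[OF t] sy(3)[OF t] i by (simp add: w_def field_simps)
    qed
    ultimately have "((\<lambda>\<tau>. (x \<tau> $ i + y \<tau> $ i) / 2) has_real_derivative
      (A *\<^sub>v z t + w t \<cdot>\<^sub>v col B 0) $ i) (at t within {0..})" by simp
    thus "((\<lambda>\<tau>. z \<tau> $ i) has_real_derivative (A *\<^sub>v z t + w t \<cdot>\<^sub>v col B 0) $ i) (at t within {0..})"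
      by (rule has_field_derivative_transform_within[where d = 1]) (use t i zi in auto)
  qed (rule cont)
  have par: "q (x t) (u t) + q (y t) (v t) = 2 * q (z t) (w t) + 2 * q (d t) (e t)" if t: "0 \<le> t" for t
  proof -
    have "(\<Sum>i<n. \<Sum>j<n. Q $$ (i, j) * (x t $ i * x t $ j)) + (\<Sum>i<n. \<Sum>j<n. Q $$ (i, j) * (y t $ i * y t $ j))
      = 2 * (\<Sum>i<n. \<Sum>j<n. Q $$ (i, j) * (z t $ i * z t $ j)) + 2 * (\<Sum>i<n. \<Sum>j<n. Q $$ (i, j) * (d t $ i * d t $ j))"
      unfolding sum_distrib_left sum.distrib[symmetric]
      by (intro sum.cong refl) (simp add: zi[OF t] di[OF t] field_simps)
    moreover have "R * (u t * u t) + R * (v t * v t) = 2 * (R * (w t * w t)) + 2 * (R * (e t * e t))"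
      by (simp add: w_def e_def field_simps)
    ultimately show ?thesis by (simp add: q_def)
  qed
  have mx: "(\<lambda>t. ennreal (indicator {0..} t *\<^sub>R q (x t) (u t))) \<in> borel_measurable lborel"
    and my: "(\<lambda>t. ennreal (indicator {0..} t *\<^sub>R q (y t) (v t))) \<in> borel_measurable lborel"
    and mz: "(\<lambda>t. ennreal (indicator {0..} t *\<^sub>R q (z t) (w t))) \<in> borel_measurable lborel"
    and md: "(\<lambda>t. ennreal (indicator {0..} t *\<^sub>R q (d t) (e t))) \<in> borel_measurable lborel"
    by (rule meas; intro sx sy cont zcont dcont; assumption)+
  have "cost x u + cost y v
    = (\<integral>\<^sup>+ t. ennreal (indicator {0..} t *\<^sub>R q (x t) (u t)) + ennreal (indicator {0..} t *\<^sub>R q (y t) (v t)) \<partial>lborel)"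
    unfolding cost_def by (rule nn_integral_add[OF mx my, symmetric])
  also have "\<dots> = (\<integral>\<^sup>+ t. 2 * ennreal (indicator {0..} t *\<^sub>R q (z t) (w t)) + 2 * ennreal (indicator {0..} t *\<^sub>R q (d t) (e t)) \<partial>lborel)"
  proof (rule nn_integral_cong)
    fix t :: real
    show "ennreal (indicator {0..} t *\<^sub>R q (x t) (u t)) + ennreal (indicator {0..} t *\<^sub>R q (y t) (v t))
      = 2 * ennreal (indicator {0..} t *\<^sub>R q (z t) (w t)) + 2 * ennreal (indicator {0..} t *\<^sub>R q (d t) (e t))"
    proof (cases "0 \<le> t")
      case True
      note nn = q0[OF sx(3)[OF True]] q0[OF sy(3)[OF True]] q0[OF zc[OF True]] q0[OF dc[OF True]]
      have "ennreal (q (x t) (u t)) + ennreal (q (y t) (v t)) = ennreal (2 * q (z t) (w t) + 2 * q (d t) (e t))"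
        using nn par[OF True] by (simp add: ennreal_plus[symmetric] del: ennreal_plus)
      also have "\<dots> = 2 * ennreal (q (z t) (w t)) + 2 * ennreal (q (d t) (e t))"
        using nn by (simp add: ennreal_mult')
      finally show ?thesis using True by simp
    qed simp
  qed
  also have "\<dots> = 2 * cost z w + 2 * cost d e"
    unfolding cost_def using mz md by (simp add: nn_integral_add nn_integral_cmult)
  finally have sum: "cost x u + cost y v = 2 * cost z w + 2 * cost d e" .
  have lez: "cost x u \<le> cost z w" using opt[OF z] qc[OF sx(3)] qc[OF zc] by simp
  have ley: "cost y v \<le> cost x u" using le qc[OF sx(3)] qc[OF sy(3)] by simp
  have finx: "cost x u < \<infinity>" using fin qc[OF sx(3)] by simp
  \<comment> \<open>The midpoint costs at least as much as \<open>x\<close>, and \<open>y\<close> at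
    most as much, so the parallelogram identity leaves nothing for the half difference once the
    finite cost of \<open>x\<close> is cancelled.\<close>
  have "cost d e = 0"
  proof -
    have "2 * cost x u + 2 * cost d e \<le> 2 * cost z w + 2 * cost d e"
      using lez by (intro add_right_mono mult_left_mono) auto
    also have "\<dots> \<le> cost x u + cost x u" unfolding sum[symmetric] using ley by (rule add_left_mono)
    finally have "2 * cost x u + 2 * cost d e \<le> 2 * cost x u + 0" by (simp add: mult_2)
    moreover have "2 * cost x u < \<infinity>" using finx by (simp add: ennreal_mult_less_top)
    ultimately have "2 * cost d e \<le> 0" by (simp only: ennreal_add_left_cancel_le) auto
    thus ?thesis by simp
  qed
  hence ae: "AE t in lborel. ennreal (indicator {0..} t *\<^sub>R q (d t) (e t)) = 0"
    unfolding cost_def using nn_integral_0_iff_AE[OF md] by simp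
  \<comment> \<open>The integrand vanishes only almost everywhere, but if \<open>e 0\<close> were
    nonzero, continuity and \<open>R > 0\<close> would make the integrand positive on an interval
    \<open>{0..<\<delta>}\<close> of positive measure.\<close>
  have "e 0 = 0"
  proof (rule ccontr)
    assume "e 0 \<noteq> 0"
    then obtain \<delta> where \<delta>: "0 < \<delta>" "\<And>t. 0 \<le> t \<Longrightarrow> dist t 0 < \<delta> \<Longrightarrow> dist (e t) (e 0) < \<bar>e 0\<bar>"
      using cont(2) unfolding continuous_on_iff by (metis atLeast_iff order_refl zero_less_abs_iff)
    have "AE t in lborel. \<not> (0 \<le> t \<and> t < \<delta>)"
      using ae
    proof eventually_elim
      case (elim t)
      show ?case
      proof
        assume t: "0 \<le> t \<and> t < \<delta>"
        hence "e t \<noteq> 0" using \<delta>(2)[of t] by (auto simp: dist_real_def)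
        hence "0 < e t * e t" using not_real_square_gt_zero by blast
        with R have "0 < R * (e t * e t)" by (rule mult_pos_pos)
        hence "0 < q (d t) (e t)" using q_ge[OF dc, of t "e t"] t by simp
        thus False using elim t by (simp add: ennreal_eq_0_iff)
      qed
    qed
    hence "emeasure lborel {t \<in> space lborel. 0 \<le> t \<and> t < \<delta>} = 0" by (rule emeasure_eq_0_AE)
    moreover have "{t \<in> space lborel. 0 \<le> t \<and> t < \<delta>} = {0..<\<delta>}" by auto
    ultimately show False using \<delta>(1) by simp
  qed
  thus ?thesis by (simp add: e_def)
qed

section \<open>The output-feedback filter\<close>

text \<open>Stated for an arbitrary row \<open>c\<close> in order to be iterated along
  \<open>C * A ^\<^sub>m j\<close>: one differentiation appends a factor \<open>A\<close> and lets
  the input in through \<open>c * B\<close>.\<close>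

lemma output_derivative:
  fixes x :: "real \<Rightarrow> real vec"
  assumes x: "state_response A B x0 u x" and A: "A \<in> carrier_mat n n" and B: "B \<in> carrier_mat n 1"
    and c: "c \<in> carrier_mat 1 n" and t: "0 \<le> t"
  shows "((\<lambda>\<tau>. row c 0 \<bullet> x \<tau>) has_real_derivative
    row (c * A) 0 \<bullet> x t + u t * (c * B) $$ (0, 0)) (at t within {0..})"
proof -
  note sr = state_responseD[OF x A]
  have c0: "row c 0 \<in> carrier_vec n" and b0: "col B 0 \<in> carrier_vec n"
    using B c by auto
  have eq: "row c 0 \<bullet> x t = (\<Sum>i<n. row c 0 $ i * x t $ i)" if "0 \<le> t" for t
    using sr(3)[OF that] by (simp add: scalar_prod_def atLeast0LessThan)
  have "((\<lambda>\<tau>. \<Sum>i<n. row c 0 $ i * x \<tau> $ i) has_real_derivative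
    (\<Sum>i<n. row c 0 $ i * (A *\<^sub>v x t + u t \<cdot>\<^sub>v col B 0) $ i)) (at t within {0..})"
    by (intro DERIV_sum DERIV_cmult sr(4)[OF t]) auto
  moreover have "(\<Sum>i<n. row c 0 $ i * (A *\<^sub>v x t + u t \<cdot>\<^sub>v col B 0) $ i)
    = row c 0 \<bullet> (A *\<^sub>v x t + u t \<cdot>\<^sub>v col B 0)"
    using A B by (simp add: scalar_prod_def atLeast0LessThan)
  also have "\<dots> = row c 0 \<bullet> (A *\<^sub>v x t) + u t * (row c 0 \<bullet> col B 0)"
    using A B c0 b0 sr(3)[OF t] scalar_prod_add_distrib[OF c0, of "A *\<^sub>v x t" "u t \<cdot>\<^sub>v col B 0"]
    by simp
  also have "row c 0 \<bullet> (A *\<^sub>v x t) = (c *\<^sub>v (A *\<^sub>v x t)) $ 0" using c by simp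
  also have "c *\<^sub>v (A *\<^sub>v x t) = (c * A) *\<^sub>v x t" using assoc_mult_mat_vec[OF c A sr(3)[OF t]] by simp
  also have "((c * A) *\<^sub>v x t) $ 0 = row (c * A) 0 \<bullet> x t" using c by simp
  also have "row c 0 \<bullet> col B 0 = (c * B) $$ (0, 0)" using c B by simp
  ultimately have "((\<lambda>\<tau>. \<Sum>i<n. row c 0 $ i * x \<tau> $ i) has_real_derivative
    row (c * A) 0 \<bullet> x t + u t * (c * B) $$ (0, 0)) (at t within {0..})" by simp
  thus ?thesis
    by (rule has_field_derivative_transform_within[where d = 1]) (use t eq in auto)
qed

text \<open>Uniqueness has to cover the one-sided derivative at \<open>t = 0\<close>; restricting to
  the right neighbourhood handles every \<open>t \<ge> 0\<close> uniformly.\<close>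

lemma DERIV_unique_atLeast:
  fixes f :: "real \<Rightarrow> real"
  assumes f: "(f has_real_derivative a) (at t within {0..})"
    and g: "(g has_real_derivative b) (at t within {0..})"
    and eq: "\<And>s. 0 \<le> s \<Longrightarrow> f s = g s" and t: "0 \<le> t"
  shows "a = b"
proof -
  have "(f has_real_derivative b) (at t within {0..})"
    by (rule has_field_derivative_transform_within[OF g, of 1]) (use t eq in auto)
  with f have "(f has_real_derivative a) (at_right t)" "(f has_real_derivative b) (at_right t)"
    using t unfolding at_within_Ici_at_right[symmetric]
    by (auto elim!: DERIV_subset)
  thus ?thesis
    using vector_derivative_unique_within[of t "{t<..}"]
    by (simp add: has_real_derivative_iff_has_vector_derivative)
qed

text \<open>
  As the Markov parameters \<open>C A\<^sup>i B\<close> with \<open>i < n - 1\<close> vanish, the first \<open>n - 1\<close> derivatives of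
  the output do not see the input: \<open>y\<close>, \<open>y'\<close>, ... are the entries of the observability matrix
  applied to the state.
\<close>

lemma eta_filter_iff_state_feedback:
  fixes x :: "real \<Rightarrow> real vec"
  assumes A: "A \<in> carrier_mat n n" and B: "B \<in> carrier_mat n 1" and C: "C \<in> carrier_mat 1 n"
    and D: "D $$ (0, 0) = 0" and L: "L \<in> carrier_mat 1 n" and n: "0 < n"
    and markov: "\<And>i. Suc i < n \<Longrightarrow> (C * A ^\<^sub>m i * B) $$ (0, 0) = 0"
  shows "eta_filter A B C D L x0 uf x u yf \<longleftrightarrow>
    state_feedback_filter A B (L * observability_matrix n A C) x0 uf x u yf"
proof (cases "state_response A B x0 u x")
  case True
  note sr = state_responseD[OF True A]
  let ?O = "observability_matrix n A C"
  define y where "y j t = row (C * A ^\<^sub>m j) 0 \<bullet> x t" for j t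
  have O: "?O \<in> carrier_mat n n" by (rule observability_matrix_index[OF A C])
  have dimL: "dim_col L = n" using L by simp
  have feedback: "row (L * ?O) 0 \<bullet> x t = (\<Sum>j<n. L $$ (0, j) * y j t)" if "0 \<le> t" for t
  proof -
    have "row (L * ?O) 0 \<bullet> x t = ((L * ?O) *\<^sub>v x t) $ 0" using L by simp
    also have "(L * ?O) *\<^sub>v x t = L *\<^sub>v (?O *\<^sub>v x t)" by (rule assoc_mult_mat_vec[OF L O sr(3)[OF that]])
    also have "(L *\<^sub>v (?O *\<^sub>v x t)) $ 0 = (\<Sum>j<n. L $$ (0, j) * (?O *\<^sub>v x t) $ j)"
      using L O by (simp add: scalar_prod_def atLeast0LessThan)
    also have "\<dots> = (\<Sum>j<n. L $$ (0, j) * y j t)"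
      using O observability_matrix_index(2)[OF A C] by (intro sum.cong) (auto simp: y_def)
    finally show ?thesis .
  qed
  have y': "(y j has_real_derivative y (Suc j) t) (at t within {0..})" if "Suc j < n" "0 \<le> t" for j t
  proof -
    have "C * A ^\<^sub>m j * A = C * A ^\<^sub>m Suc j" using assoc_mult_mat[OF C pow_carrier_mat[OF A] A] by simp
    thus ?thesis
      using output_derivative[OF True A B _ that(2), of "C * A ^\<^sub>m j"] markov[OF that(1)] A C
      unfolding y_def by simp
  qed
  have y0: "y 0 t = row C 0 \<bullet> x t + D $$ (0, 0) * u t" for t using C A D by (simp add: y_def)
  show ?thesis
  proof
    assume "eta_filter A B C D L x0 uf x u yf"
    then obtain yd where
      *: "\<forall>t\<ge>0. yd 0 t = row C 0 \<bullet> x t + D $$ (0, 0) * u t"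
        "\<forall>j. Suc j < n \<longrightarrow>
          (\<forall>t\<ge>0. (yd j has_real_derivative yd (Suc j) t) (at t within {0..}))"
        "\<forall>t\<ge>0. yf t = (\<Sum>j<n. L $$ (0, j) * yd j t) \<and> u t = uf t - yf t"
      unfolding eta_filter_def dimL by blast
    have yd: "(yd j has_real_derivative yd (Suc j) t) (at t within {0..})" if "Suc j < n" "0 \<le> t" for j t
      using * that by blast
    \<comment> \<open>Derivatives are unique, so any admissible family of output derivatives
      coincides with \<open>y\<close> up to order \<open>n - 1\<close>, beyond which the controller
      does not look.\<close>
    have "j < n \<Longrightarrow> \<forall>t\<ge>0. yd j t = y j t" for j
    proof (induction j)
      case (Suc j)
      show ?case
      proof (intro allI impI)
        fix t :: real assume t: "0 \<le> t"
        show "yd (Suc j) t = y (Suc j) t"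
          by (rule DERIV_unique_atLeast[OF yd[OF Suc.prems t] y'[OF Suc.prems t] _ t])
            (use Suc in simp)
      qed
    qed (use * y0 in simp)
    thus "state_feedback_filter A B (L * ?O) x0 uf x u yf"
      using True * feedback unfolding state_feedback_filter_def by simp
  next
    assume "state_feedback_filter A B (L * ?O) x0 uf x u yf"
    hence yf: "yf t = (\<Sum>j<n. L $$ (0, j) * y j t)" "u t = uf t - yf t" if "0 \<le> t" for t
      using that feedback[OF that] by (simp_all add: state_feedback_filter_def)
    show "eta_filter A B C D L x0 uf x u yf"
      unfolding eta_filter_def dimL by (intro conjI exI[of _ y] allI impI True y0 y' yf)
  qed
qed (simp add: eta_filter_def state_feedback_filter_def)

section \<open>Relative degree\<close>

text \<open>Cross-multiplying with the reduced fraction shows that cancelling common factors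
  preserves the difference of degrees, so no coprimality is required.\<close>

lemma relative_degree_divide:
  assumes "p \<noteq> 0" "q \<noteq> 0"
  shows "relative_degree (to_fract p / to_fract q) = int (degree q) - int (degree p)"
proof -
  define f where "f = to_fract p / to_fract q"
  obtain a b where ab: "quot_of_fract f = (a, b)" by fastforce
  have b: "b \<noteq> 0" using snd_quot_of_fract_nonzero[of f] ab by simp
  have f: "f = to_fract a / to_fract b"
    using Fract_quot_of_fract[of f] ab by (simp add: Fract_conv_to_fract)
  hence "to_fract (p * b) = to_fract (a * q)"
    using assms b unfolding f_def by (simp add: field_simps)
  hence eq: "p * b = a * q" by (simp only: to_fract_eq_iff)
  hence "a \<noteq> 0" using assms b by auto
  hence "degree p + degree b = degree a + degree q"
    using arg_cong[OF eq, of degree] assms b by (simp add: degree_mult_eq)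
  thus ?thesis unfolding f_def[symmetric] relative_degree_def ab by simp
qed

lemma coeff_eta:
  assumes "L \<in> carrier_mat 1 n"
  shows "coeff (eta L) j = (if j < n then L $$ (0, j) else 0)"
  using assms by (simp add: eta_def coeff_sum)

text \<open>The filter is \<open>\<eta> / (p + \<eta>)\<close>. A nonzero last coefficient gives the
  numerator degree exactly \<open>n - 1\<close>, and the denominator keeps degree
  \<open>n\<close>.\<close>

lemma relative_degree_filter_tf:
  assumes p: "degree p = n" "p \<noteq> 0" and L: "L \<in> carrier_mat 1 n" and n: "0 < n"
    and last: "L $$ (0, n - 1) \<noteq> 0"
  shows "relative_degree (filter_tf (1 / to_fract p) L) = 1"
proof -
  have deg: "degree (eta L) = n - 1"
  proof (rule antisym)
    show "degree (eta L) \<le> n - 1" by (rule degree_le) (use n in \<open>auto simp: coeff_eta[OF L]\<close>)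
    show "n - 1 \<le> degree (eta L)" by (rule le_degree) (use n last in \<open>simp add: coeff_eta[OF L]\<close>)
  qed
  have eta0: "eta L \<noteq> 0" using last n coeff_eta[OF L, of "n - 1"] by auto
  have degp: "degree (p + eta L) = n" using deg p n by (simp add: degree_add_eq_left)
  hence nz: "p + eta L \<noteq> 0" using n by auto
  have eq: "filter_tf (1 / to_fract p) L = to_fract (eta L) / to_fract (p + eta L)"
  proof -
    have "1 + to_fract (eta L) / to_fract p = to_fract (p + eta L) / to_fract p"
      using p(2) by (simp add: add_divide_distrib)
    thus ?thesis using p(2) by (simp add: filter_tf_def Let_def)
  qed
  show ?thesis unfolding eq relative_degree_divide[OF eta0 nz] deg degp using n by simp
qed

section \<open>Optimality and uniqueness of the coefficients, and the relative degree of the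
  filter\<close>

theorem proposition4:
  fixes k m n :: nat and \<omega> :: "nat \<Rightarrow> real"
    and A B C D Q K :: "real mat" and R :: real
  assumes "\<And>i. i \<in> {1..k} \<Longrightarrow> \<omega> i > 0"
    and "inj_on \<omega> {1..k}"
    and "n = 2 * k + 1"
    and "minimal_realization (signal_model k \<omega>) m A B C D"
    and "pos_semidef m Q"
    and "R > 0"
    and "lqr_optimal_gain A B Q R K"
  shows "invertible_mat (observability_matrix n A C) \<and>
         (\<forall>K\<eta>. optimal_eta_coeffs n A B C D Q R K\<eta> \<longleftrightarrow>
                K\<eta> = K * the (mat_inverse (observability_matrix n A C))) \<and>
         relative_degree (filter_tf (signal_model k \<omega>)
            (K * the (mat_inverse (observability_matrix n A C)))) = 1"
proof -
  let ?O = "observability_matrix n A C"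
  define p where "p = signal_poly k \<omega>"
  define Oi where "Oi = the (mat_inverse ?O)"
  have n: "0 < n" using assms(3) by simp
  have p: "degree p = n" "coeff p n = 1"
    using degree_monic_signal_poly[of k \<omega>] assms(3) by (auto simp: p_def)
  have V: "signal_model k \<omega> = 1 / to_fract p" unfolding p_def by (rule signal_model_eq)
  note min = assms(4)[unfolded V]
  note mr = minimal_realization_inverse_poly[OF min n p]
  have A: "A \<in> carrier_mat n n" and B: "B \<in> carrier_mat n 1" and C: "C \<in> carrier_mat 1 n"
    using min mr(1) unfolding minimal_realization_def realization_def by auto
  have Q: "pos_semidef n Q" and Qc: "Q \<in> carrier_mat n n"
    using assms(5) mr(1) by (auto simp: pos_semidef_def)
  have dimA: "dim_row A = n" using A by simp
  from assms(7) have K: "K \<in> carrier_mat 1 n" and hur: "hurwitz (A - B * K)"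
    and lqr: "\<And>x0. x0 \<in> carrier_vec n \<Longrightarrow> \<exists>x u yf. state_feedback_filter A B K x0 (\<lambda>_. 0) x u yf \<and>
          (\<forall>x' u'. state_response A B x0 u' x' \<longrightarrow> quadratic_cost Q R x u \<le> quadratic_cost Q R x' u')"
    unfolding lqr_optimal_gain_def dimA by blast+
  note markov = markov_parameters[OF A B C mr(3)]
  have O: "?O \<in> carrier_mat n n" by (rule observability_matrix_index[OF A C])
  note Oi = mat_inverse_det_nonzero[OF O det_observability_matrix[OF A B C mr(3)], folded Oi_def]
  have inv: "invertible_mat ?O"
    unfolding invertible_mat_def inverts_mat_def using O Oi by auto
  define L where "L = K * Oi"
  have L: "L \<in> carrier_mat 1 n" using K Oi by (simp add: L_def)
  have LO: "L * ?O = K" unfolding L_def using assoc_mult_mat[OF K Oi(1) O] K Oi by simp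
  have eta: "eta_filter A B C D M x0 uf x u yf \<longleftrightarrow> state_feedback_filter A B (M * ?O) x0 uf x u yf"
    if "M \<in> carrier_mat 1 n" for M x0 uf u yf and x :: "real \<Rightarrow> real vec"
    by (rule eta_filter_iff_state_feedback[OF A B C mr(4) that n]) (simp add: markov)
  have response: "state_response A B x0 u x" if "eta_filter A B C D M x0 uf x u yf"
    for M x0 uf u yf and x :: "real \<Rightarrow> real vec"
    using that by (simp add: eta_filter_def)
  have "optimal_eta_coeffs n A B C D Q R M \<longleftrightarrow> M = L" for M
  proof
    assume eqL: "M = L"
    show "optimal_eta_coeffs n A B C D Q R M"
      unfolding optimal_eta_coeffs_def dimA eqL
    proof (intro conjI ballI L)
      fix x0 :: "real vec" assume "x0 \<in> carrier_vec n"
      then obtain x u yf where x: "state_feedback_filter A B K x0 (\<lambda>_. 0) x u yf"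
        and opt: "\<And>x' u'. state_response A B x0 u' x' \<Longrightarrow> quadratic_cost Q R x u \<le> quadratic_cost Q R x' u'"
        using lqr by blast
      \<comment> \<open>With \<open>L * ?O = K\<close> the optimal state-feedback trajectory is one
        of the coefficient filter with \<open>L\<close>; every competing coefficient filter is in
        particular a state response, and so is covered by LQR optimality over all inputs.\<close>
      show "\<exists>x u yf. eta_filter A B C D L x0 (\<lambda>_. 0) x u yf \<and>
          (\<forall>K\<eta>'\<in>carrier_mat 1 n. \<forall>x' u' yf'. eta_filter A B C D K\<eta>' x0 (\<lambda>_. 0) x' u' yf' \<longrightarrow>
             quadratic_cost Q R x u \<le> quadratic_cost Q R x' u')"
        unfolding eta[OF L] LO
        by (rule exI[of _ x], rule exI[of _ u], rule exI[of _ yf])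
          (intro conjI ballI allI impI x opt, erule response)
    qed
  next
    assume M_opt: "optimal_eta_coeffs n A B C D Q R M"
    hence M: "M \<in> carrier_mat 1 n" by (simp add: optimal_eta_coeffs_def)
    hence MO: "M * ?O \<in> carrier_mat 1 n" using O by simp
    \<comment> \<open>Both feedbacks generate optimal inputs from \<open>x0\<close>. These agree at
      time 0, where the state is \<open>x0\<close>, so the gains act equally on every
      vector.\<close>
    have gain: "row (M * ?O) 0 \<bullet> x0 = row K 0 \<bullet> x0" if x0: "x0 \<in> carrier_vec n" for x0
    proof -
      obtain x u yf where x: "state_feedback_filter A B K x0 (\<lambda>_. 0) x u yf"
        and opt: "\<And>x' u'. state_response A B x0 u' x' \<Longrightarrow> quadratic_cost Q R x u \<le> quadratic_cost Q R x' u'"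
        using lqr[OF x0] by blast
      obtain y v yg where y: "eta_filter A B C D M x0 (\<lambda>_. 0) y v yg"
        and le: "\<And>N x' u' yf'. N \<in> carrier_mat 1 n \<Longrightarrow> eta_filter A B C D N x0 (\<lambda>_. 0) x' u' yf' \<Longrightarrow>
             quadratic_cost Q R y v \<le> quadratic_cost Q R x' u'"
        using M_opt x0 unfolding optimal_eta_coeffs_def dimA by blast
      have y': "state_feedback_filter A B (M * ?O) x0 (\<lambda>_. 0) y v yg" using y eta[OF M] by simp
      have sx: "state_response A B x0 u x" and u: "\<And>t. 0 \<le> t \<Longrightarrow> u t = - (row K 0 \<bullet> x t)"
        using x by (auto simp: state_feedback_filter_def)
      have sy: "state_response A B x0 v y" and v: "\<And>t. 0 \<le> t \<Longrightarrow> v t = - (row (M * ?O) 0 \<bullet> y t)"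
        using y' by (auto simp: state_feedback_filter_def)
      have fin: "quadratic_cost Q R x u < \<infinity>"
        by (rule quadratic_cost_finite[OF A B K Qc hur sx u])
      \<comment> \<open>The LQR trajectory is available to the coefficient problem through
        \<open>L\<close>, so the optimal \<open>M\<close> costs no more than it.\<close>
      have "eta_filter A B C D L x0 (\<lambda>_. 0) x u yf" unfolding eta[OF L] LO by (rule x)
      hence le': "quadratic_cost Q R y v \<le> quadratic_cost Q R x u" by (rule le[OF L])
      have "u 0 = v 0"
        by (rule optimal_input_unique[OF A B Q assms(6) sx sy]) (rule opt fin le', assumption?)+
      moreover have "x 0 = x0" "y 0 = x0" using sx sy by (auto simp: state_response_def)
      ultimately show ?thesis using u[of 0] v[of 0] by simp
    qed
    have "M * ?O = K"
    proof (rule eq_matI)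
      fix i j assume "i < dim_row K" "j < dim_col K"
      hence i: "i = 0" and j: "j < n" using K by auto
      have unit: "row c 0 \<bullet> unit_vec n j = c $$ (0, j)" if "c \<in> carrier_mat 1 n" for c :: "real mat"
        using scalar_prod_right_unit[OF j, of "row c 0"] that j by auto
      have "(M * ?O) $$ (0, j) = row (M * ?O) 0 \<bullet> unit_vec n j" by (rule unit[OF MO, symmetric])
      also have "\<dots> = row K 0 \<bullet> unit_vec n j" by (rule gain) simp
      also have "\<dots> = K $$ (0, j)" by (rule unit[OF K])
      finally show "(M * ?O) $$ (i, j) = K $$ (i, j)" using i by simp
    qed (use MO K in auto)
    hence "K * Oi = M * (?O * Oi)" using assoc_mult_mat[OF M O Oi(1)] by simp
    thus "M = L" using Oi(2) M by (simp add: L_def)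
  qed
  moreover have "relative_degree (filter_tf (signal_model k \<omega>) L) = 1"
    unfolding V
  proof (rule relative_degree_filter_tf[OF p(1) _ L n])
    show "p \<noteq> 0" using p(2) by auto
    \<comment> \<open>The last entry of \<open>L\<close> is \<open>K B\<close>, which is minus the trace of the stable matrix \<open>A - B K\<close>.\<close>
    have OB: "(?O * B) $$ (j, 0) = (if Suc j = n then 1 else 0)" if "j < n" for j
      using observability_matrix_mult[OF A C B that, of 0] markov[OF that] by simp
    have "(K * B) $$ (0, 0) = (L * (?O * B)) $$ (0, 0)"
      using assoc_mult_mat[OF L O B] LO by simp
    also have "\<dots> = (\<Sum>j<n. L $$ (0, j) * (?O * B) $$ (j, 0))"
      using L O B by (simp add: scalar_prod_def atLeast0LessThan)
    also have "\<dots> = (\<Sum>j<n. if j = n - 1 then L $$ (0, j) else 0)"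
      using OB n by (intro sum.cong) auto
    also have "\<dots> = L $$ (0, n - 1)" using n by simp
    finally have KB: "(K * B) $$ (0, 0) = L $$ (0, n - 1)" .
    \<comment> \<open>The trace is read off at index \<open>n - 1 = 2 * k\<close>, an even index of
      an odd polynomial.\<close>
    have "mat_trace A = 0"
      using coeff_char_poly_trace[OF A n] coeff_signal_poly_even[of "n - 1" k \<omega>] assms(3)
      unfolding mr(2) p_def by simp
    moreover have "mat_trace (A - B * K) = mat_trace A - mat_trace (B * K)"
      using A B K by (simp add: mat_trace_def sum_subtractf)
    moreover have "mat_trace (B * K) = (K * B) $$ (0, 0)"
      using mat_trace_mult_commute[OF B K] K B by (simp add: mat_trace_def)
    moreover have "mat_trace (A - B * K) < 0"
      by (rule hurwitz_trace_neg[OF _ hur n]) (use A B K in auto)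
    ultimately show "L $$ (0, n - 1) \<noteq> 0" using KB by simp
  qed
  ultimately show ?thesis using inv unfolding L_def Oi_def by simp
qed

end
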